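(* Let $\mathbb{A}$ and $\mathbb{X}$ be double categories with folding (respectively cofolding) and let $F\colon\mathbb{X}\to\mathbb{A}$ and $G\colon\mathbb{A}\to\mathbb{X}$ be double functors compatible with the foldings (respectively cofoldings). Then $F$ and $G$ are horizontal double adjoints ($F\dashv G$) if and only if their horizontal 2-functors $\mathbf{H}F$ and $\mathbf{H}G$ are 2-adjoints ($\mathbf{H}F\dashv\mathbf{H}G$).
   Context: **Double categories.** Double categories are strict (internal categories in $\mathbf{Cat}$): objects, horizontal morphisms, vertical morphisms, squares. $[\alpha\ \beta]$ denotes horizontal composition ($\alpha$ on the left; $[f\ g]=g\circ f$). The horizontal 2-category $\mathbf{H}\mathbb{D}$ has the objects and horizontal morphisms of $\mathbb{D}$, and as 2-cells (top to bottom) the squares with identity vertical sides; $\mathbf{H}F$ is the restriction of a double functor $F$. **Horizontal double adjunction.** An adjunction in the 2-category of double categories, double functors and horizontal natural transformations. A horizontal natural transformation $\theta\colon F\Rightarrow G$ assigns to each object $A$ a horizontal morphism $\theta_A\colon FA\to GA$ and to each vertical morphism $j\colon A\to C$ a square $\theta_j$ with left $Fj$, right $Gj$, top $\theta_A$, bottom $\theta_C$, preserving vertical composition and identities ($\theta_{1^v_A}$ is the vertical identity square of $\theta_A$), with $[F\alpha\ \theta_k]=[\theta_j\ G\alpha]$ for each square $\alpha$ with left $j$ and right $k$. A 2-adjunction is an adjunction in the 2-category of 2-categories, 2-functors and 2-natural transformations. **Folding.** For a 2-category $\mathbf{K}$, the double category of direct quintets $\mathbb{Q}\mathbf{K}$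 has objects those of $\mathbf{K}$, horizontal and vertical morphisms the morphisms of $\mathbf{K}$, and squares with top $f$, bottom $g$, left $j$, right $k$ the 2-cells $k\circ f\Rightarrow g\circ j$, composed by pasting. A folding on $\mathbb{D}$ is a double functor $\Lambda\colon\mathbb{D}\to\mathbb{Q}\mathbf{H}\mathbb{D}$ that is the identity on $\mathbf{H}\mathbb{D}$ and fully faithful (bijective for each fixed boundary) on squares: it sends each vertical $j\colon A\to C$ functorially to a horizontal $\overline{j}\colon A\to C$ (the holonomy) and gives bijections from squares with top $f$, bottom $g$, left $j$, right $k$ to 2-cells $[f\ \overline{k}]\Rightarrow[\overline{j}\ g]$ in $\mathbf{H}\mathbb{D}$. A double functor $F$ is compatible with foldings if $F(\overline{j})=\overline{F(j)}$ and $F(\Lambda(\alpha))=\Lambda(F(\alpha))$ for all vertical $j$ and squares $\alpha$. **Cofolding.** The double category of inverse quintets $\overline{\mathbb{Q}}\mathbf{K}$ has the same objects and horizontal morphisms as $\mathbf{K}$, vertical 1-category the opposite of the underlying 1-category of $\mathbf{K}$, and squares with top $f\colon A\to B$, bottom $g\colon C\to D$, left $j^{op}$ ($j\colon C\to A$), right $k^{op}$ ($k\colon D\to B$) the 2-cells $f\circ j\Rightarrow k\circ g$, composed by pasting. A cofolding on $\mathbb{D}$ is a double functor $\Lambda\colon\mathbb{D}\to\overline{\mathbb{Q}}\mathbf{H}\mathbb{D}$ that is the identity on $\mathbf{H}\mathbb{D}$ and fully faithful on squares: it sends each vertical $j\colon A\to C$ functorially to a horizontal $j^*\colon C\to A$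 (the coholonomy) and gives bijections from squares with top $f$, bottom $g$, left $j$, right $k$ to 2-cells $[j^*\ f]\Rightarrow[g\ k^*]$. A double functor $F$ is compatible with cofoldings if $F(j^* )=F(j)^*$ and $F(\Lambda(\alpha))=\Lambda(F(\alpha))$. *)

theory Defs
  imports Main
begin

section \<open>Categories and functors\<close>

text \<open>Composition is written in diagrammatic order throughout:
  \<open>cmp C f g\<close> is \<open>[f g]\<close>, that is, \<open>g\<close> after \<open>f\<close>. All axioms are relative to
  the carriers \<open>Ob\<close> and \<open>Mor\<close>.\<close>

record ('o, 'm) cat =
  Ob :: "'o set"
  Mor :: "'m set"
  src :: "'m \<Rightarrow> 'o"
  tgt :: "'m \<Rightarrow> 'o"
  ide :: "'o \<Rightarrow> 'm"
  cmp :: "'m \<Rightarrow> 'm \<Rightarrow> 'm"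

locale category =
  fixes C :: "('o, 'm) cat"
  assumes src_in: "f \<in> Mor C \<Longrightarrow> src C f \<in> Ob C"
    and tgt_in: "f \<in> Mor C \<Longrightarrow> tgt C f \<in> Ob C"
    and ide_in: "a \<in> Ob C \<Longrightarrow> ide C a \<in> Mor C"
    and src_ide: "a \<in> Ob C \<Longrightarrow> src C (ide C a) = a"
    and tgt_ide: "a \<in> Ob C \<Longrightarrow> tgt C (ide C a) = a"
    and cmp_in: "\<lbrakk>f \<in> Mor C; g \<in> Mor C; tgt C f = src C g\<rbrakk> \<Longrightarrow> cmp C f g \<in> Mor C"
    and src_cmp: "\<lbrakk>f \<in> Mor C; g \<in> Mor C; tgt C f = src C g\<rbrakk> \<Longrightarrow> src C (cmp C f g) = src C f"
    and tgt_cmp: "\<lbrakk>f \<in> Mor C; g \<in> Mor C; tgt C f = src C g\<rbrakk> \<Longrightarrow> tgt C (cmp C f g) = tgt C g"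
    and ide_cmp: "f \<in> Mor C \<Longrightarrow> cmp C (ide C (src C f)) f = f"
    and cmp_ide: "f \<in> Mor C \<Longrightarrow> cmp C f (ide C (tgt C f)) = f"
    and cmp_assoc: "\<lbrakk>f \<in> Mor C; g \<in> Mor C; h \<in> Mor C; tgt C f = src C g; tgt C g = src C h\<rbrakk>
      \<Longrightarrow> cmp C (cmp C f g) h = cmp C f (cmp C g h)"

locale cat_functor =
  dom: category C + cod: category D
  for C :: "('o, 'm) cat" and D :: "('p, 'n) cat"
    and fo :: "'o \<Rightarrow> 'p" and fm :: "'m \<Rightarrow> 'n" +
  assumes ob_in: "a \<in> Ob C \<Longrightarrow> fo a \<in> Ob D"
    and mor_in: "f \<in> Mor C \<Longrightarrow> fm f \<in> Mor D"
    and src_map: "f \<in> Mor C \<Longrightarrow> src D (fm f) = fo (src C f)"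
    and tgt_map: "f \<in> Mor C \<Longrightarrow> tgt D (fm f) = fo (tgt C f)"
    and ide_map: "a \<in> Ob C \<Longrightarrow> fm (ide C a) = ide D (fo a)"
    and cmp_map: "\<lbrakk>f \<in> Mor C; g \<in> Mor C; tgt C f = src C g\<rbrakk>
      \<Longrightarrow> fm (cmp C f g) = cmp D (fm f) (fm g)"

definition op_cat :: "('o, 'm) cat \<Rightarrow> ('o, 'm) cat" where
  "op_cat C = \<lparr>Ob = Ob C, Mor = Mor C, src = tgt C, tgt = src C, ide = ide C,
     cmp = (\<lambda>f g. cmp C g f)\<rparr>"


section \<open>Strict 2-categories\<close>

text \<open>\<open>cat1\<close> is the underlying category of objects and 1-cells, \<open>catv\<close> has the 1-cells as
  objects and the 2-cells under vertical composition as morphisms, and \<open>cath\<close> has the objects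
  as objects and the 2-cells under horizontal composition as morphisms.\<close>

record ('o, 'm, 'c) tcat =
  cat1 :: "('o, 'm) cat"
  catv :: "('m, 'c) cat"
  cath :: "('o, 'c) cat"

locale two_category =
  one: category "cat1 K" + vert: category "catv K" + horiz: category "cath K" +
  src2: cat_functor "cath K" "cat1 K" id "src (catv K)" +
  tgt2: cat_functor "cath K" "cat1 K" id "tgt (catv K)" +
  ide2: cat_functor "cat1 K" "cath K" id "ide (catv K)"
  for K :: "('o, 'm, 'c) tcat" +
  assumes Ob_cath: "Ob (cath K) = Ob (cat1 K)"
    and Ob_catv: "Ob (catv K) = Mor (cat1 K)"
    and Mor_cath: "Mor (cath K) = Mor (catv K)"
    and interchange:
      "\<lbrakk>a \<in> Mor (catv K); b \<in> Mor (catv K); c \<in> Mor (catv K); d \<in> Mor (catv K);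
        tgt (cath K) a = src (cath K) b; tgt (cath K) c = src (cath K) d;
        tgt (catv K) a = src (catv K) c; tgt (catv K) b = src (catv K) d\<rbrakk>
      \<Longrightarrow> cmp (catv K) (cmp (cath K) a b) (cmp (cath K) c d)
          = cmp (cath K) (cmp (catv K) a c) (cmp (catv K) b d)"

record ('o, 'm, 'c, 'p, 'n, 'd) tfun =
  ob2 :: "'o \<Rightarrow> 'p"
  one2 :: "'m \<Rightarrow> 'n"
  two2 :: "'c \<Rightarrow> 'd"

locale two_functor =
  dom2: two_category K + cod2: two_category L +
  f1: cat_functor "cat1 K" "cat1 L" "ob2 T" "one2 T" +
  fv: cat_functor "catv K" "catv L" "one2 T" "two2 T" +
  fh: cat_functor "cath K" "cath L" "ob2 T" "two2 T"
  for K :: "('o, 'm, 'c) tcat" and L :: "('p, 'n, 'd) tcat"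
    and T :: "('o, 'm, 'c, 'p, 'n, 'd) tfun"

definition tfun_id :: "('o, 'm, 'c, 'o, 'm, 'c) tfun" where
  "tfun_id = \<lparr>ob2 = id, one2 = id, two2 = id\<rparr>"

text \<open>\<open>tfun_comp S T\<close> is \<open>T\<close> after \<open>S\<close>.\<close>

definition tfun_comp ::
  "('o, 'm, 'c, 'p, 'n, 'd) tfun \<Rightarrow> ('p, 'n, 'd, 'q, 'l, 'e) tfun \<Rightarrow> ('o, 'm, 'c, 'q, 'l, 'e) tfun"
  where "tfun_comp S T =
    \<lparr>ob2 = ob2 T \<circ> ob2 S, one2 = one2 T \<circ> one2 S, two2 = two2 T \<circ> two2 S\<rparr>"

locale two_natural_transformation =
  S: two_functor K L S + T: two_functor K L T
  for K :: "('o, 'm, 'c) tcat" and L :: "('p, 'n, 'd) tcat"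
    and S T :: "('o, 'm, 'c, 'p, 'n, 'd) tfun"
    and \<sigma> :: "'o \<Rightarrow> 'n" +
  assumes comp_in: "a \<in> Ob (cat1 K) \<Longrightarrow> \<sigma> a \<in> Mor (cat1 L)"
    and src_comp: "a \<in> Ob (cat1 K) \<Longrightarrow> src (cat1 L) (\<sigma> a) = ob2 S a"
    and tgt_comp: "a \<in> Ob (cat1 K) \<Longrightarrow> tgt (cat1 L) (\<sigma> a) = ob2 T a"
    and natural1: "f \<in> Mor (cat1 K) \<Longrightarrow>
      cmp (cat1 L) (one2 S f) (\<sigma> (tgt (cat1 K) f)) = cmp (cat1 L) (\<sigma> (src (cat1 K) f)) (one2 T f)"
    and natural2: "c \<in> Mor (cath K) \<Longrightarrow>
      cmp (cath L) (two2 S c) (ide (catv L) (\<sigma> (tgt (cath K) c)))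
      = cmp (cath L) (ide (catv L) (\<sigma> (src (cath K) c))) (two2 T c)"

locale two_adjunction =
  left: two_functor K L S + right: two_functor L K T +
  unit: two_natural_transformation K K tfun_id "tfun_comp S T" \<eta> +
  counit: two_natural_transformation L L "tfun_comp T S" tfun_id \<epsilon>
  for K :: "('o, 'm, 'c) tcat" and L :: "('p, 'n, 'd) tcat"
    and S :: "('o, 'm, 'c, 'p, 'n, 'd) tfun" and T :: "('p, 'n, 'd, 'o, 'm, 'c) tfun"
    and \<eta> :: "'o \<Rightarrow> 'm" and \<epsilon> :: "'p \<Rightarrow> 'n" +
  assumes triangle_left: "a \<in> Ob (cat1 K) \<Longrightarrow>
      cmp (cat1 L) (one2 S (\<eta> a)) (\<epsilon> (ob2 S a)) = ide (cat1 L) (ob2 S a)"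
    and triangle_right: "b \<in> Ob (cat1 L) \<Longrightarrow>
      cmp (cat1 K) (\<eta> (ob2 T b)) (one2 T (\<epsilon> b)) = ide (cat1 K) (ob2 T b)"

definition two_adjoint ::
  "('o, 'm, 'c) tcat \<Rightarrow> ('p, 'n, 'd) tcat
   \<Rightarrow> ('o, 'm, 'c, 'p, 'n, 'd) tfun \<Rightarrow> ('p, 'n, 'd, 'o, 'm, 'c) tfun \<Rightarrow> bool"
  where "two_adjoint K L S T \<longleftrightarrow> (\<exists>\<eta> \<epsilon>. two_adjunction K L S T \<eta> \<epsilon>)"


section \<open>Strict double categories\<close>

text \<open>\<open>hcat\<close> and \<open>vcat\<close> are the categories of horizontal and of vertical morphisms. The squares
  are the morphisms of two categories: \<open>sqh\<close>, with the vertical morphisms as objects and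
  horizontal composition, and \<open>sqv\<close>, with the horizontal morphisms as objects and vertical
  composition. Thus the left and right sides of a square are its source and target in \<open>sqh\<close>, its
  top and bottom are those in \<open>sqv\<close>, \<open>ide sqh j\<close> is the horizontal identity square of a vertical
  \<open>j\<close>, and \<open>ide sqv f\<close> is the vertical identity square of a horizontal \<open>f\<close>.\<close>

record ('o, 'h, 'v, 's) dcat =
  hcat :: "('o, 'h) cat"
  vcat :: "('o, 'v) cat"
  sqh :: "('v, 's) cat"
  sqv :: "('h, 's) cat"

abbreviation "sq_left D \<equiv> src (sqh D)"
abbreviation "sq_right D \<equiv> tgt (sqh D)"
abbreviation "sq_top D \<equiv> src (sqv D)"
abbreviation "sq_bot D \<equiv> tgt (sqv D)"

text \<open>An internal category in \<open>Cat\<close>: all structure maps of either direction are functorial for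
  the other one. The functors \<open>top\<close> to \<open>right\<close> also say that the corners of a square match.\<close>

locale double_category =
  hor: category "hcat D" + ver: category "vcat D" +
  sqh: category "sqh D" + sqv: category "sqv D" +
  top: cat_functor "sqh D" "hcat D" "src (vcat D)" "sq_top D" +
  bot: cat_functor "sqh D" "hcat D" "tgt (vcat D)" "sq_bot D" +
  left: cat_functor "sqv D" "vcat D" "src (hcat D)" "sq_left D" +
  right: cat_functor "sqv D" "vcat D" "tgt (hcat D)" "sq_right D" +
  ideh: cat_functor "vcat D" "sqv D" "ide (hcat D)" "ide (sqh D)" +
  idev: cat_functor "hcat D" "sqh D" "ide (vcat D)" "ide (sqv D)"
  for D :: "('o, 'h, 'v, 's) dcat" +
  assumes Ob_vcat: "Ob (vcat D) = Ob (hcat D)"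
    and Ob_sqh: "Ob (sqh D) = Mor (vcat D)"
    and Ob_sqv: "Ob (sqv D) = Mor (hcat D)"
    and Mor_sqh: "Mor (sqh D) = Mor (sqv D)"
    and interchange:
      "\<lbrakk>a \<in> Mor (sqv D); b \<in> Mor (sqv D); c \<in> Mor (sqv D); d \<in> Mor (sqv D);
        sq_right D a = sq_left D b; sq_right D c = sq_left D d;
        sq_bot D a = sq_top D c; sq_bot D b = sq_top D d\<rbrakk>
      \<Longrightarrow> cmp (sqv D) (cmp (sqh D) a b) (cmp (sqh D) c d)
          = cmp (sqh D) (cmp (sqv D) a c) (cmp (sqv D) b d)"

record ('o, 'h, 'v, 's, 'p, 'k, 'w, 't) dfun =
  obd :: "'o \<Rightarrow> 'p"
  hord :: "'h \<Rightarrow> 'k"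
  verd :: "'v \<Rightarrow> 'w"
  sqd :: "'s \<Rightarrow> 't"

locale double_functor =
  domd: double_category D + codd: double_category E +
  fhor: cat_functor "hcat D" "hcat E" "obd F" "hord F" +
  fver: cat_functor "vcat D" "vcat E" "obd F" "verd F" +
  fsqh: cat_functor "sqh D" "sqh E" "verd F" "sqd F" +
  fsqv: cat_functor "sqv D" "sqv E" "hord F" "sqd F"
  for D :: "('o, 'h, 'v, 's) dcat" and E :: "('p, 'k, 'w, 't) dcat"
    and F :: "('o, 'h, 'v, 's, 'p, 'k, 'w, 't) dfun"

definition dfun_id :: "('o, 'h, 'v, 's, 'o, 'h, 'v, 's) dfun" where
  "dfun_id = \<lparr>obd = id, hord = id, verd = id, sqd = id\<rparr>"

text \<open>\<open>dfun_comp F G\<close> is \<open>G\<close> after \<open>F\<close>.\<close>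

definition dfun_comp ::
  "('o, 'h, 'v, 's, 'p, 'k, 'w, 't) dfun \<Rightarrow> ('p, 'k, 'w, 't, 'q, 'l, 'x, 'u) dfun
   \<Rightarrow> ('o, 'h, 'v, 's, 'q, 'l, 'x, 'u) dfun"
  where "dfun_comp F G =
    \<lparr>obd = obd G \<circ> obd F, hord = hord G \<circ> hord F, verd = verd G \<circ> verd F, sqd = sqd G \<circ> sqd F\<rparr>"

text \<open>A horizontal natural transformation consists of the components \<open>to\<close> at objects and \<open>tv\<close> at
  vertical morphisms. That the top and bottom of \<open>tv j\<close> are the components at the source and
  target of \<open>j\<close>, and that vertical composition and identities are preserved, is the
  functoriality \<open>comps\<close>.\<close>

locale horizontal_transformation =
  F: double_functor D E F + G: double_functor D E G +
  comps: cat_functor "vcat D" "sqv E" to tv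
  for D :: "('o, 'h, 'v, 's) dcat" and E :: "('p, 'k, 'w, 't) dcat"
    and F G :: "('o, 'h, 'v, 's, 'p, 'k, 'w, 't) dfun"
    and to :: "'o \<Rightarrow> 'k" and tv :: "'v \<Rightarrow> 't" +
  assumes src_comp: "a \<in> Ob (hcat D) \<Longrightarrow> src (hcat E) (to a) = obd F a"
    and tgt_comp: "a \<in> Ob (hcat D) \<Longrightarrow> tgt (hcat E) (to a) = obd G a"
    and left_comp: "j \<in> Mor (vcat D) \<Longrightarrow> sq_left E (tv j) = verd F j"
    and right_comp: "j \<in> Mor (vcat D) \<Longrightarrow> sq_right E (tv j) = verd G j"
    and natural: "s \<in> Mor (sqh D) \<Longrightarrow>
      cmp (sqh E) (sqd F s) (tv (sq_right D s)) = cmp (sqh E) (tv (sq_left D s)) (sqd G s)"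

text \<open>The triangle identities \<open>\<epsilon>F \<circ> F\<eta> = 1\<^sub>F\<close> and \<open>G\<epsilon> \<circ> \<eta>G = 1\<^sub>G\<close>, each at objects and at
  vertical morphisms.\<close>

locale horizontal_double_adjunction =
  left: double_functor X A F + right: double_functor A X G +
  unit: horizontal_transformation X X dfun_id "dfun_comp F G" \<eta>o \<eta>v +
  counit: horizontal_transformation A A "dfun_comp G F" dfun_id \<epsilon>o \<epsilon>v
  for X :: "('o, 'h, 'v, 's) dcat" and A :: "('p, 'k, 'w, 't) dcat"
    and F :: "('o, 'h, 'v, 's, 'p, 'k, 'w, 't) dfun"
    and G :: "('p, 'k, 'w, 't, 'o, 'h, 'v, 's) dfun"
    and \<eta>o :: "'o \<Rightarrow> 'h" and \<eta>v :: "'v \<Rightarrow> 's" and \<epsilon>o :: "'p \<Rightarrow> 'k" and \<epsilon>v :: "'w \<Rightarrow> 't" +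
  assumes triangle_left_ob: "x \<in> Ob (hcat X) \<Longrightarrow>
      cmp (hcat A) (hord F (\<eta>o x)) (\<epsilon>o (obd F x)) = ide (hcat A) (obd F x)"
    and triangle_left_ver: "j \<in> Mor (vcat X) \<Longrightarrow>
      cmp (sqh A) (sqd F (\<eta>v j)) (\<epsilon>v (verd F j)) = ide (sqh A) (verd F j)"
    and triangle_right_ob: "a \<in> Ob (hcat A) \<Longrightarrow>
      cmp (hcat X) (\<eta>o (obd G a)) (hord G (\<epsilon>o a)) = ide (hcat X) (obd G a)"
    and triangle_right_ver: "k \<in> Mor (vcat A) \<Longrightarrow>
      cmp (sqh X) (\<eta>v (verd G k)) (sqd G (\<epsilon>v k)) = ide (sqh X) (verd G k)"

definition horizontal_double_adjoint ::
  "('o, 'h, 'v, 's) dcat \<Rightarrow> ('p, 'k, 'w, 't) dcat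
   \<Rightarrow> ('o, 'h, 'v, 's, 'p, 'k, 'w, 't) dfun \<Rightarrow> ('p, 'k, 'w, 't, 'o, 'h, 'v, 's) dfun \<Rightarrow> bool"
  where "horizontal_double_adjoint X A F G \<longleftrightarrow>
    (\<exists>\<eta>o \<eta>v \<epsilon>o \<epsilon>v. horizontal_double_adjunction X A F G \<eta>o \<eta>v \<epsilon>o \<epsilon>v)"


section \<open>The horizontal 2-category\<close>

definition globular :: "('o, 'h, 'v, 's) dcat \<Rightarrow> 's set" where
  "globular D = {s \<in> Mor (sqv D).
     sq_left D s = ide (vcat D) (src (hcat D) (sq_top D s)) \<and>
     sq_right D s = ide (vcat D) (tgt (hcat D) (sq_top D s))}"

definition H_cat :: "('o, 'h, 'v, 's) dcat \<Rightarrow> ('o, 'h, 's) tcat" where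
  "H_cat D =
    \<lparr>cat1 = hcat D,
     catv = (sqv D)\<lparr>Mor := globular D\<rparr>,
     cath = \<lparr>Ob = Ob (hcat D), Mor = globular D,
       src = (\<lambda>s. src (hcat D) (sq_top D s)), tgt = (\<lambda>s. tgt (hcat D) (sq_top D s)),
       ide = (\<lambda>a. ide (sqh D) (ide (vcat D) a)), cmp = cmp (sqh D)\<rparr>\<rparr>"

definition H_fun ::
  "('o, 'h, 'v, 's, 'p, 'k, 'w, 't) dfun \<Rightarrow> ('o, 'h, 's, 'p, 'k, 't) tfun" where
  "H_fun F = \<lparr>ob2 = obd F, one2 = hord F, two2 = sqd F\<rparr>"


section \<open>Direct and inverse quintets\<close>

text \<open>A square of quintets is a 2-cell together with its boundary of 1-cells, in the order top,
  bottom, left, right.\<close>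

datatype ('m, 'c) quintet =
  Quintet (qtop: 'm) (qbot: 'm) (qleft: 'm) (qright: 'm) (qcell: 'c)

text \<open>Left whiskering \<open>f * c\<close> and right whiskering \<open>c * f\<close>, again diagrammatically.\<close>

definition lwhisk :: "('o, 'm, 'c) tcat \<Rightarrow> 'm \<Rightarrow> 'c \<Rightarrow> 'c" where
  "lwhisk K f c = cmp (cath K) (ide (catv K) f) c"

definition rwhisk :: "('o, 'm, 'c) tcat \<Rightarrow> 'c \<Rightarrow> 'm \<Rightarrow> 'c" where
  "rwhisk K c f = cmp (cath K) c (ide (catv K) f)"

text \<open>Direct quintets: \<open>f: A \<rightarrow> B\<close>, \<open>g: C \<rightarrow> D\<close>, \<open>j: A \<rightarrow> C\<close>, \<open>k: B \<rightarrow> D\<close> and a 2-cell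
  \<open>[f k] \<Rightarrow> [j g]\<close>.\<close>

definition quintets :: "('o, 'm, 'c) tcat \<Rightarrow> ('m, 'c) quintet set" where
  "quintets K = {Quintet f g j k c | f g j k c.
     f \<in> Mor (cat1 K) \<and> g \<in> Mor (cat1 K) \<and> j \<in> Mor (cat1 K) \<and> k \<in> Mor (cat1 K) \<and>
     src (cat1 K) f = src (cat1 K) j \<and> tgt (cat1 K) f = src (cat1 K) k \<and>
     src (cat1 K) g = tgt (cat1 K) j \<and> tgt (cat1 K) g = tgt (cat1 K) k \<and>
     c \<in> Mor (catv K) \<and>
     src (catv K) c = cmp (cat1 K) f k \<and> tgt (catv K) c = cmp (cat1 K) j g}"

text \<open>Pasting a square \<open>p\<close> with the square \<open>q\<close> to its right:
  \<open>[f f' l] \<Rightarrow> [f k g'] \<Rightarrow> [j g g']\<close>. Pasting a square \<open>p\<close> with the square \<open>q\<close> below it: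
  \<open>[f k k'] \<Rightarrow> [j g k'] \<Rightarrow> [j j' h]\<close>.\<close>

definition Q_cat :: "('o, 'm, 'c) tcat \<Rightarrow> ('o, 'm, 'm, ('m, 'c) quintet) dcat" where
  "Q_cat K =
    \<lparr>hcat = cat1 K,
     vcat = cat1 K,
     sqh = \<lparr>Ob = Mor (cat1 K), Mor = quintets K, src = qleft, tgt = qright,
       ide = (\<lambda>j. Quintet (ide (cat1 K) (src (cat1 K) j)) (ide (cat1 K) (tgt (cat1 K) j)) j j
                   (ide (catv K) j)),
       cmp = (\<lambda>p q. Quintet (cmp (cat1 K) (qtop p) (qtop q)) (cmp (cat1 K) (qbot p) (qbot q))
                     (qleft p) (qright q)
                     (cmp (catv K) (lwhisk K (qtop p) (qcell q)) (rwhisk K (qcell p) (qbot q))))\<rparr>,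
     sqv = \<lparr>Ob = Mor (cat1 K), Mor = quintets K, src = qtop, tgt = qbot,
       ide = (\<lambda>f. Quintet f f (ide (cat1 K) (src (cat1 K) f)) (ide (cat1 K) (tgt (cat1 K) f))
                   (ide (catv K) f)),
       cmp = (\<lambda>p q. Quintet (qtop p) (qbot q)
                     (cmp (cat1 K) (qleft p) (qleft q)) (cmp (cat1 K) (qright p) (qright q))
                     (cmp (catv K) (rwhisk K (qcell p) (qright q)) (lwhisk K (qleft p) (qcell q))))\<rparr>\<rparr>"

text \<open>Inverse quintets: \<open>f: A \<rightarrow> B\<close>, \<open>g: C \<rightarrow> D\<close>, \<open>j: C \<rightarrow> A\<close>, \<open>k: D \<rightarrow> B\<close> and a 2-cell
  \<open>[j f] \<Rightarrow> [g k]\<close>. The vertical morphism \<open>j\<^sup>o\<^sup>p: A \<rightarrow> C\<close> is represented by \<open>j\<close> itself.\<close>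

definition inverse_quintets :: "('o, 'm, 'c) tcat \<Rightarrow> ('m, 'c) quintet set" where
  "inverse_quintets K = {Quintet f g j k c | f g j k c.
     f \<in> Mor (cat1 K) \<and> g \<in> Mor (cat1 K) \<and> j \<in> Mor (cat1 K) \<and> k \<in> Mor (cat1 K) \<and>
     src (cat1 K) f = tgt (cat1 K) j \<and> tgt (cat1 K) f = tgt (cat1 K) k \<and>
     src (cat1 K) g = src (cat1 K) j \<and> tgt (cat1 K) g = src (cat1 K) k \<and>
     c \<in> Mor (catv K) \<and>
     src (catv K) c = cmp (cat1 K) j f \<and> tgt (catv K) c = cmp (cat1 K) g k}"

text \<open>Pasting a square \<open>p\<close> with the square \<open>q\<close> to its right:
  \<open>[j f f'] \<Rightarrow> [g k f'] \<Rightarrow> [g g' l]\<close>. Pasting a square \<open>p\<close> with the square \<open>q\<close> below it: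
  \<open>[j' j f] \<Rightarrow> [j' g k] \<Rightarrow> [h k' k]\<close>.\<close>

definition Qbar_cat :: "('o, 'm, 'c) tcat \<Rightarrow> ('o, 'm, 'm, ('m, 'c) quintet) dcat" where
  "Qbar_cat K =
    \<lparr>hcat = cat1 K,
     vcat = op_cat (cat1 K),
     sqh = \<lparr>Ob = Mor (cat1 K), Mor = inverse_quintets K, src = qleft, tgt = qright,
       ide = (\<lambda>j. Quintet (ide (cat1 K) (tgt (cat1 K) j)) (ide (cat1 K) (src (cat1 K) j)) j j
                   (ide (catv K) j)),
       cmp = (\<lambda>p q. Quintet (cmp (cat1 K) (qtop p) (qtop q)) (cmp (cat1 K) (qbot p) (qbot q))
                     (qleft p) (qright q)
                     (cmp (catv K) (rwhisk K (qcell p) (qtop q)) (lwhisk K (qbot p) (qcell q))))\<rparr>,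
     sqv = \<lparr>Ob = Mor (cat1 K), Mor = inverse_quintets K, src = qtop, tgt = qbot,
       ide = (\<lambda>f. Quintet f f (ide (cat1 K) (src (cat1 K) f)) (ide (cat1 K) (tgt (cat1 K) f))
                   (ide (catv K) f)),
       cmp = (\<lambda>p q. Quintet (qtop p) (qbot q)
                     (cmp (cat1 K) (qleft q) (qleft p)) (cmp (cat1 K) (qright q) (qright p))
                     (cmp (catv K) (lwhisk K (qleft q) (qcell p)) (rwhisk K (qcell q) (qright p))))\<rparr>\<rparr>"


section \<open>Foldings and cofoldings\<close>

definition squares :: "('o, 'h, 'v, 's) dcat \<Rightarrow> 'h \<Rightarrow> 'h \<Rightarrow> 'v \<Rightarrow> 'v \<Rightarrow> 's set" where
  "squares D f g j k =
    {s \<in> Mor (sqv D). sq_top D s = f \<and> sq_bot D s = g \<and> sq_left D s = j \<and> sq_right D s = k}"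

definition fully_faithful_on_squares ::
  "('o, 'h, 'v, 's) dcat \<Rightarrow> ('p, 'k, 'w, 't) dcat
   \<Rightarrow> ('o, 'h, 'v, 's, 'p, 'k, 'w, 't) dfun \<Rightarrow> bool"
  where "fully_faithful_on_squares D E F \<longleftrightarrow>
    (\<forall>f\<in>Mor (hcat D). \<forall>g\<in>Mor (hcat D). \<forall>j\<in>Mor (vcat D). \<forall>k\<in>Mor (vcat D).
       src (hcat D) f = src (vcat D) j \<and> tgt (hcat D) f = src (vcat D) k \<and>
       src (hcat D) g = tgt (vcat D) j \<and> tgt (hcat D) g = tgt (vcat D) k \<longrightarrow>
       bij_betw (sqd F) (squares D f g j k)
         (squares E (hord F f) (hord F g) (verd F j) (verd F k)))"

text \<open>Being the identity on the horizontal 2-category: a 2-cell \<open>c\<close> of \<open>H_cat D\<close> is identified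
  with the quintet on \<open>c\<close> whose vertical sides are identities. It serves for direct and inverse
  quintets alike.\<close>

definition identity_on_H ::
  "('o, 'h, 'v, 's) dcat \<Rightarrow> ('o, 'h, 'v, 's, 'o, 'h, 'h, ('h, 's) quintet) dfun \<Rightarrow> bool"
  where "identity_on_H D \<Lambda> \<longleftrightarrow>
    (\<forall>a\<in>Ob (hcat D). obd \<Lambda> a = a) \<and>
    (\<forall>f\<in>Mor (hcat D). hord \<Lambda> f = f) \<and>
    (\<forall>c\<in>globular D. sqd \<Lambda> c =
       Quintet (sq_top D c) (sq_bot D c)
         (ide (hcat D) (src (hcat D) (sq_top D c))) (ide (hcat D) (tgt (hcat D) (sq_top D c))) c)"

text \<open>The holonomy of a vertical \<open>j\<close> is \<open>verd \<Lambda> j\<close>, and likewise for the coholonomy below.\<close>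

locale double_folding =
  double_functor D "Q_cat (H_cat D)" \<Lambda>
  for D :: "('o, 'h, 'v, 's) dcat"
    and \<Lambda> :: "('o, 'h, 'v, 's, 'o, 'h, 'h, ('h, 's) quintet) dfun" +
  assumes identity: "identity_on_H D \<Lambda>"
    and fully_faithful: "fully_faithful_on_squares D (Q_cat (H_cat D)) \<Lambda>"

locale double_cofolding =
  double_functor D "Qbar_cat (H_cat D)" \<Lambda>
  for D :: "('o, 'h, 'v, 's) dcat"
    and \<Lambda> :: "('o, 'h, 'v, 's, 'o, 'h, 'h, ('h, 's) quintet) dfun" +
  assumes identity: "identity_on_H D \<Lambda>"
    and fully_faithful: "fully_faithful_on_squares D (Qbar_cat (H_cat D)) \<Lambda>"

text \<open>Compatibility of \<open>F: D \<rightarrow> E\<close> with given foldings, or with given cofoldings, of \<open>D\<close> and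
  \<open>E\<close>; here \<open>F\<close> acts on quintets by acting on the boundary and on the 2-cell.\<close>

definition compatible ::
  "('o, 'h, 'v, 's) dcat
   \<Rightarrow> ('o, 'h, 'v, 's, 'o, 'h, 'h, ('h, 's) quintet) dfun
   \<Rightarrow> ('p, 'k, 'w, 't, 'p, 'k, 'k, ('k, 't) quintet) dfun
   \<Rightarrow> ('o, 'h, 'v, 's, 'p, 'k, 'w, 't) dfun \<Rightarrow> bool"
  where "compatible D \<Lambda>D \<Lambda>E F \<longleftrightarrow>
    (\<forall>j\<in>Mor (vcat D). hord F (verd \<Lambda>D j) = verd \<Lambda>E (verd F j)) \<and>
    (\<forall>s\<in>Mor (sqv D). map_quintet (hord F) (sqd F) (sqd \<Lambda>D s) = sqd \<Lambda>E (sqd F s))"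

end

theory Submission
  imports Defs
begin

text \<open>
  Restricting a horizontal transformation to its components at objects gives a 2-natural
  transformation of the horizontal 2-categories, so a double adjunction restricts to a 2-adjunction.
  Conversely, call a square commuting if the folding (or cofolding) sends it to an identity 2-cell.
  Commuting squares are closed under both compositions, are preserved by compatible double functors
  and are determined by their boundary. For a 2-natural transformation \<open>\<sigma>\<close> the naturality
  square of \<open>\<sigma>\<close> at the holonomy of a vertical morphism \<open>j\<close> commutes, hence comes from a unique
  commuting square, which is the component at \<open>j\<close>. Functoriality of these components and the
  triangle identities at vertical morphisms are equations between commuting squares, so they only
  need to be checked on boundaries; naturality for arbitrary squares is 2-naturality of \<open>\<sigma>\<close> at the
  2-cell that represents the square.
\<close>


section \<open>Restriction to the horizontal 2-category\<close>

context double_category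
begin

text \<open>Carriers are normalised to those of \<open>hcat\<close> and \<open>sqv\<close> and to
  \<open>Mor (vcat D)\<close>, and the corners of a square are expressed through its vertical sides.
  Associativity and interchange stay out and are cited where they matter.\<close>

lemmas dc_simps = Ob_vcat Ob_sqh Ob_sqv Mor_sqh
  hor.src_in hor.tgt_in hor.ide_in hor.src_ide hor.tgt_ide hor.cmp_in hor.src_cmp hor.tgt_cmp
  hor.ide_cmp hor.cmp_ide
  ver.src_in[unfolded Ob_vcat] ver.tgt_in[unfolded Ob_vcat] ver.ide_in[unfolded Ob_vcat]
  ver.src_ide[unfolded Ob_vcat] ver.tgt_ide[unfolded Ob_vcat] ver.cmp_in ver.src_cmp ver.tgt_cmp
  ver.ide_cmp ver.cmp_ide
  sqh.src_in[unfolded Ob_sqh Mor_sqh] sqh.tgt_in[unfolded Ob_sqh Mor_sqh]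
  sqh.ide_in[unfolded Ob_sqh Mor_sqh] sqh.src_ide[unfolded Ob_sqh] sqh.tgt_ide[unfolded Ob_sqh]
  sqh.cmp_in[unfolded Mor_sqh] sqh.src_cmp[unfolded Mor_sqh] sqh.tgt_cmp[unfolded Mor_sqh]
  sqh.ide_cmp[unfolded Mor_sqh] sqh.cmp_ide[unfolded Mor_sqh]
  sqv.src_in[unfolded Ob_sqv] sqv.tgt_in[unfolded Ob_sqv]
  sqv.ide_in[unfolded Ob_sqv] sqv.src_ide[unfolded Ob_sqv] sqv.tgt_ide[unfolded Ob_sqv]
  sqv.cmp_in sqv.src_cmp sqv.tgt_cmp sqv.ide_cmp sqv.cmp_ide
  top.src_map[unfolded Mor_sqh] top.tgt_map[unfolded Mor_sqh]
  bot.src_map[unfolded Mor_sqh] bot.tgt_map[unfolded Mor_sqh]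
  top.ide_map[unfolded Ob_sqh] top.cmp_map[unfolded Mor_sqh]
  bot.ide_map[unfolded Ob_sqh] bot.cmp_map[unfolded Mor_sqh]
  left.ide_map[unfolded Ob_sqv] left.cmp_map right.ide_map[unfolded Ob_sqv] right.cmp_map

text \<open>Corner matching forces an object whose identity is a side of \<open>s\<close> to be the
  corresponding end of the top edge, so the existential form loses nothing and treats top and bottom
  alike.\<close>

lemma globular_iff:
  "s \<in> globular D \<longleftrightarrow> s \<in> Mor (sqv D) \<and>
     (\<exists>a\<in>Ob (hcat D). sq_left D s = ide (vcat D) a) \<and> (\<exists>b\<in>Ob (hcat D). sq_right D s = ide (vcat D) b)"
  by (auto simp: globular_def dc_simps)

lemma ide_sqv_globular: "f \<in> Mor (hcat D) \<Longrightarrow> ide (sqv D) f \<in> globular D"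
  by (auto simp: globular_iff dc_simps)

text \<open>This is what makes the identity 2-cell on an identity 1-cell the unit for horizontal
  composition in \<open>H_cat D\<close>.\<close>

lemma ide_ide_eq: "a \<in> Ob (hcat D) \<Longrightarrow> ide (sqv D) (ide (hcat D) a) = ide (sqh D) (ide (vcat D) a)"
  by (simp add: idev.ide_map)

text \<open>The shared edge fixes the vertical sides of both squares as identities at its two ends,
  and an identity composed with itself is that identity.\<close>

lemma cmp_sqv_globular:
  assumes "s \<in> globular D" "t \<in> globular D" "sq_bot D s = sq_top D t"
  shows "cmp (sqv D) s t \<in> globular D"
proof -
  obtain a b c d where st: "s \<in> Mor (sqv D)" "t \<in> Mor (sqv D)"
    "a \<in> Ob (hcat D)" "b \<in> Ob (hcat D)" "c \<in> Ob (hcat D)" "d \<in> Ob (hcat D)"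
    "sq_left D s = ide (vcat D) a" "sq_right D s = ide (vcat D) b"
    "sq_left D t = ide (vcat D) c" "sq_right D t = ide (vcat D) d"
    using assms(1,2) unfolding globular_iff by blast
  have "a = src (hcat D) (sq_bot D s)" "b = tgt (hcat D) (sq_bot D s)"
    "c = src (hcat D) (sq_top D t)" "d = tgt (hcat D) (sq_top D t)"
    using st by (simp_all add: dc_simps)
  then have "c = a" "d = b" using assms(3) by simp_all
  moreover have "cmp (vcat D) (ide (vcat D) x) (ide (vcat D) x) = ide (vcat D) x"
    if "x \<in> Ob (hcat D)" for x
    using ver.ide_cmp[of "ide (vcat D) x"] that by (simp add: dc_simps)
  ultimately show ?thesis
    using st assms(3) by (auto simp: globular_iff dc_simps)
qed

lemma category_catv: "category (catv (H_cat D))"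
proof -
  have "cmp (sqv D) s t \<in> globular D"
    if "s \<in> globular D" "t \<in> globular D" "sq_bot D s = sq_top D t" for s t
    using that by (rule cmp_sqv_globular)
  moreover have "ide (sqv D) f \<in> globular D" if "f \<in> Mor (hcat D)" for f
    using that by (rule ide_sqv_globular)
  moreover have "s \<in> Mor (sqv D)" if "s \<in> globular D" for s
    using that by (simp add: globular_iff)
  ultimately show ?thesis
    by unfold_locales (auto simp: H_cat_def dc_simps sqv.cmp_assoc)
qed

lemma category_cath: "category (cath (H_cat D))"
proof -
  have "cmp (sqh D) (ide (sqh D) (ide (vcat D) a)) s = s"
    if "s \<in> Mor (sqv D)" "sq_left D s = ide (vcat D) a" for s a
    using that sqh.ide_cmp[of s] by (simp add: Mor_sqh)
  moreover have "cmp (sqh D) s (ide (sqh D) (ide (vcat D) b)) = s"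
    if "s \<in> Mor (sqv D)" "sq_right D s = ide (vcat D) b" for s b
    using that sqh.cmp_ide[of s] by (simp add: Mor_sqh)
  ultimately show ?thesis
    by unfold_locales (auto simp: H_cat_def dc_simps globular_iff sqh.cmp_assoc)
qed

lemma cmp_sqh_ide_sqv:
  assumes "f \<in> Mor (hcat D)" "g \<in> Mor (hcat D)" "tgt (hcat D) f = src (hcat D) g"
  shows "cmp (sqh D) (ide (sqv D) f) (ide (sqv D) g) = ide (sqv D) (cmp (hcat D) f g)"
  using assms by (simp add: idev.cmp_map)

lemma two_category_H_cat: "two_category (H_cat D)"
  by (intro two_category.intro cat_functor.intro cat_functor_axioms.intro
      two_category_axioms.intro category_catv category_cath)
    (auto simp: H_cat_def dc_simps globular_iff hor.category_axioms ide_ide_eq cmp_sqh_ide_sqv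
      interchange)

end

section \<open>The restriction of a double functor to horizontal 2-categories\<close>

context double_functor
begin

lemma df_simps:
  "a \<in> Ob (hcat D) \<Longrightarrow> obd F a \<in> Ob (hcat E)"
  "f \<in> Mor (hcat D) \<Longrightarrow> hord F f \<in> Mor (hcat E)"
  "j \<in> Mor (vcat D) \<Longrightarrow> verd F j \<in> Mor (vcat E)"
  "s \<in> Mor (sqv D) \<Longrightarrow> sqd F s \<in> Mor (sqv E)"
  "f \<in> Mor (hcat D) \<Longrightarrow> src (hcat E) (hord F f) = obd F (src (hcat D) f)"
  "f \<in> Mor (hcat D) \<Longrightarrow> tgt (hcat E) (hord F f) = obd F (tgt (hcat D) f)"
  "j \<in> Mor (vcat D) \<Longrightarrow> src (vcat E) (verd F j) = obd F (src (vcat D) j)"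
  "j \<in> Mor (vcat D) \<Longrightarrow> tgt (vcat E) (verd F j) = obd F (tgt (vcat D) j)"
  "s \<in> Mor (sqv D) \<Longrightarrow> sq_left E (sqd F s) = verd F (sq_left D s)"
  "s \<in> Mor (sqv D) \<Longrightarrow> sq_right E (sqd F s) = verd F (sq_right D s)"
  "s \<in> Mor (sqv D) \<Longrightarrow> sq_top E (sqd F s) = hord F (sq_top D s)"
  "s \<in> Mor (sqv D) \<Longrightarrow> sq_bot E (sqd F s) = hord F (sq_bot D s)"
  "a \<in> Ob (hcat D) \<Longrightarrow> hord F (ide (hcat D) a) = ide (hcat E) (obd F a)"
  "a \<in> Ob (hcat D) \<Longrightarrow> verd F (ide (vcat D) a) = ide (vcat E) (obd F a)"
  "j \<in> Mor (vcat D) \<Longrightarrow> sqd F (ide (sqh D) j) = ide (sqh E) (verd F j)"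
  "f \<in> Mor (hcat D) \<Longrightarrow> sqd F (ide (sqv D) f) = ide (sqv E) (hord F f)"
  "\<lbrakk>f \<in> Mor (hcat D); g \<in> Mor (hcat D); tgt (hcat D) f = src (hcat D) g\<rbrakk>
    \<Longrightarrow> hord F (cmp (hcat D) f g) = cmp (hcat E) (hord F f) (hord F g)"
  "\<lbrakk>j \<in> Mor (vcat D); k \<in> Mor (vcat D); tgt (vcat D) j = src (vcat D) k\<rbrakk>
    \<Longrightarrow> verd F (cmp (vcat D) j k) = cmp (vcat E) (verd F j) (verd F k)"
  "\<lbrakk>s \<in> Mor (sqv D); t \<in> Mor (sqv D); sq_right D s = sq_left D t\<rbrakk>
    \<Longrightarrow> sqd F (cmp (sqh D) s t) = cmp (sqh E) (sqd F s) (sqd F t)"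
  "\<lbrakk>s \<in> Mor (sqv D); t \<in> Mor (sqv D); sq_bot D s = sq_top D t\<rbrakk>
    \<Longrightarrow> sqd F (cmp (sqv D) s t) = cmp (sqv E) (sqd F s) (sqd F t)"
  using fhor.ob_in fhor.mor_in fver.mor_in fsqv.mor_in fhor.src_map fhor.tgt_map
    fver.src_map fver.tgt_map fsqh.src_map fsqh.tgt_map fsqv.src_map fsqv.tgt_map
    fhor.ide_map fver.ide_map fsqh.ide_map fsqv.ide_map
    fhor.cmp_map fver.cmp_map fsqh.cmp_map fsqv.cmp_map
    domd.Ob_vcat domd.Ob_sqh domd.Ob_sqv domd.Mor_sqh
  by auto

lemma sqd_globular: "s \<in> globular D \<Longrightarrow> sqd F s \<in> globular E"
  by (auto simp: domd.globular_iff codd.globular_iff df_simps)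

lemma two_functor_H_fun: "two_functor (H_cat D) (H_cat E) (H_fun F)"
  by (intro two_functor.intro cat_functor.intro cat_functor_axioms.intro
      domd.two_category_H_cat codd.two_category_H_cat
      domd.category_catv codd.category_catv domd.category_cath codd.category_cath)
    (use sqd_globular in \<open>auto simp: H_cat_def H_fun_def domd.globular_iff domd.dc_simps codd.Ob_sqv df_simps
      domd.hor.category_axioms codd.hor.category_axioms\<close>)

end

section \<open>Identities and composites; restriction of transformations and adjunctions\<close>

lemma cat_functor_id: "category C \<Longrightarrow> cat_functor C C id id"
  by (simp add: cat_functor_def cat_functor_axioms_def)

lemma cat_functor_comp:
  assumes "cat_functor B C fo fm" "cat_functor C D go gm"
  shows "cat_functor B D (go \<circ> fo) (gm \<circ> fm)"
proof -
  interpret f: cat_functor B C fo fm by fact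
  interpret g: cat_functor C D go gm by fact
  show ?thesis
    by unfold_locales (auto simp: f.ob_in f.mor_in f.src_map f.tgt_map f.ide_map f.cmp_map
        g.ob_in g.mor_in g.src_map g.tgt_map g.ide_map g.cmp_map)
qed

lemma double_functor_dfun_id: "double_category D \<Longrightarrow> double_functor D D dfun_id"
  unfolding double_functor_def dfun_id_def
  by (auto intro!: cat_functor_id simp: double_category_def)

lemma double_functor_dfun_comp:
  "\<lbrakk>double_functor C D F; double_functor D E G\<rbrakk> \<Longrightarrow> double_functor C E (dfun_comp F G)"
  unfolding double_functor_def dfun_comp_def by (auto intro: cat_functor_comp)

lemma H_fun_dfun_id: "H_fun dfun_id = tfun_id"
  by (simp add: H_fun_def dfun_id_def tfun_id_def)

lemma H_fun_dfun_comp: "H_fun (dfun_comp F G) = tfun_comp (H_fun F) (H_fun G)"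
  by (simp add: H_fun_def dfun_comp_def tfun_comp_def)

text \<open>Components at vertical identities are vertical identity squares. Hence naturality at a
  globular square is already 2-naturality, and naturality at the identity square of \<open>f\<close>
  has naturality at the 1-cell \<open>f\<close> as its top edge.\<close>

lemma (in horizontal_transformation) two_natural_transformation_H:
  "two_natural_transformation (H_cat D) (H_cat E) (H_fun F) (H_fun G) to"
proof -
  have to: "to a \<in> Mor (hcat E)" if "a \<in> Ob (hcat D)" for a
    using that comps.ob_in F.domd.Ob_vcat F.codd.Ob_sqv by auto
  have tv: "tv (ide (vcat D) a) = ide (sqv E) (to a)" if "a \<in> Ob (hcat D)" for a
    using that comps.ide_map F.domd.Ob_vcat by auto
  have tvm: "tv j \<in> Mor (sqv E)" "sq_top E (tv j) = to (src (vcat D) j)" if "j \<in> Mor (vcat D)" for j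
    using that comps.mor_in comps.src_map by auto
  have "cmp (hcat E) (hord F f) (to (tgt (hcat D) f)) = cmp (hcat E) (to (src (hcat D) f)) (hord G f)"
    if f: "f \<in> Mor (hcat D)" for f
    using arg_cong[OF natural[of "ide (sqv D) f"], of "sq_top E"] f to
    by (simp add: F.domd.dc_simps F.codd.dc_simps tv F.df_simps G.df_simps src_comp tgt_comp)
  moreover have "cmp (sqh E) (sqd F s) (ide (sqv E) (to b)) = cmp (sqh E) (ide (sqv E) (to a)) (sqd G s)"
    if "s \<in> Mor (sqv D)" "a \<in> Ob (hcat D)" "b \<in> Ob (hcat D)"
      "sq_left D s = ide (vcat D) a" "sq_right D s = ide (vcat D) b" for s a b
    using natural[of s] that by (simp add: tv F.domd.dc_simps)
  ultimately show ?thesis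
    by (intro two_natural_transformation.intro two_natural_transformation_axioms.intro
        F.two_functor_H_fun G.two_functor_H_fun)
      (auto simp: H_cat_def H_fun_def to src_comp tgt_comp F.domd.globular_iff F.domd.dc_simps)
qed

lemma (in horizontal_double_adjunction) two_adjunction_H:
  "two_adjunction (H_cat X) (H_cat A) (H_fun F) (H_fun G) \<eta>o \<epsilon>o"
  using left.two_functor_H_fun right.two_functor_H_fun
    unit.two_natural_transformation_H counit.two_natural_transformation_H
    triangle_left_ob triangle_right_ob
  by (auto simp: two_adjunction_def two_adjunction_axioms_def H_fun_dfun_id H_fun_dfun_comp)
    (auto simp: H_cat_def H_fun_def)


section \<open>Commuting squares\<close>

text \<open>Mentioning only \<open>qcell\<close> lets one definition serve foldings and cofoldings.
  The 1-cell carrying the identity need not be named, since the boundary of the cell determines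
  it.\<close>

definition commuting :: "('o, 'h, 'v, 's) dcat
    \<Rightarrow> ('o, 'h, 'v, 's, 'o, 'h, 'h, ('h, 's) quintet) dfun \<Rightarrow> 's \<Rightarrow> bool" where
  "commuting D \<Lambda> s \<longleftrightarrow> s \<in> Mor (sqv D) \<and> qcell (sqd \<Lambda> s) \<in> ide (sqv D) ` Mor (hcat D)"

section \<open>Commuting squares for a folding\<close>

context double_folding
begin

abbreviation "hol \<equiv> verd \<Lambda>"
abbreviation "cell s \<equiv> qcell (sqd \<Lambda> s)"

lemma obd_id: "a \<in> Ob (hcat D) \<Longrightarrow> obd \<Lambda> a = a"
  and hord_id: "f \<in> Mor (hcat D) \<Longrightarrow> hord \<Lambda> f = f"
  using identity by (auto simp: identity_on_H_def)

lemma hol_simps: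
  assumes "j \<in> Mor (vcat D)"
  shows "hol j \<in> Mor (hcat D)" "src (hcat D) (hol j) = src (vcat D) j"
    "tgt (hcat D) (hol j) = tgt (vcat D) j"
  using df_simps(3,7,8)[OF assms] assms by (auto simp: Q_cat_def H_cat_def obd_id domd.dc_simps)

lemma quintet_simps:
  assumes "s \<in> Mor (sqv D)"
  shows "qtop (sqd \<Lambda> s) = sq_top D s" "qbot (sqd \<Lambda> s) = sq_bot D s"
    "qleft (sqd \<Lambda> s) = hol (sq_left D s)" "qright (sqd \<Lambda> s) = hol (sq_right D s)"
  using df_simps(9-12)[OF assms] assms by (auto simp: Q_cat_def hord_id domd.dc_simps)

text \<open>Top and bottom are read off from the quintet. As the cell is globular, its sides are the
  identities at the ends of its top.\<close>

lemma cell_simps: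
  assumes "s \<in> Mor (sqv D)"
  shows "cell s \<in> Mor (sqv D)"
    "sq_top D (cell s) = cmp (hcat D) (sq_top D s) (hol (sq_right D s))"
    "sq_bot D (cell s) = cmp (hcat D) (hol (sq_left D s)) (sq_bot D s)"
    "sq_left D (cell s) = ide (vcat D) (src (vcat D) (sq_left D s))"
    "sq_right D (cell s) = ide (vcat D) (tgt (vcat D) (sq_right D s))"
proof -
  have "cell s \<in> globular D"
    and top: "sq_top D (cell s) = cmp (hcat D) (sq_top D s) (hol (sq_right D s))"
    and "sq_bot D (cell s) = cmp (hcat D) (hol (sq_left D s)) (sq_bot D s)"
    using df_simps(4)[OF assms] quintet_simps[OF assms]
    by (auto simp: Q_cat_def quintets_def H_cat_def)
  then show "cell s \<in> Mor (sqv D)"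
    "sq_top D (cell s) = cmp (hcat D) (sq_top D s) (hol (sq_right D s))"
    "sq_bot D (cell s) = cmp (hcat D) (hol (sq_left D s)) (sq_bot D s)"
    "sq_left D (cell s) = ide (vcat D) (src (vcat D) (sq_left D s))"
    "sq_right D (cell s) = ide (vcat D) (tgt (vcat D) (sq_right D s))"
    unfolding globular_def mem_Collect_eq top
    using assms by (simp_all add: hol_simps domd.dc_simps)
qed

text \<open>This is faithfulness of \<open>\<Lambda>\<close>: a quintet consists of its boundary and
  its cell, so both squares have the same image.\<close>

lemma square_eqI:
  assumes "s \<in> Mor (sqv D)" "t \<in> Mor (sqv D)" "sq_top D s = sq_top D t" "sq_bot D s = sq_bot D t"
    "sq_left D s = sq_left D t" "sq_right D s = sq_right D t" "cell s = cell t"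
  shows "s = t"
proof -
  have "inj_on (sqd \<Lambda>) (squares D (sq_top D s) (sq_bot D s) (sq_left D s) (sq_right D s))"
    using fully_faithful assms(1) unfolding fully_faithful_on_squares_def
    by (simp add: bij_betw_def domd.dc_simps)
  moreover have "sqd \<Lambda> s = sqd \<Lambda> t"
    using assms by (intro quintet.expand) (simp add: quintet_simps)
  moreover have "s \<in> squares D (sq_top D s) (sq_bot D s) (sq_left D s) (sq_right D s)"
    "t \<in> squares D (sq_top D s) (sq_bot D s) (sq_left D s) (sq_right D s)"
    using assms by (simp_all add: squares_def)
  ultimately show ?thesis by (rule inj_onD)
qed

text \<open>This is fullness of \<open>\<Lambda>\<close>: by \<open>eq\<close> the identity 2-cell
  on \<open>[j g]\<close> fills a quintet on the image boundary, and its preimage is the required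
  square.\<close>

lemma commuting_exists:
  assumes "f \<in> Mor (hcat D)" "g \<in> Mor (hcat D)" "j \<in> Mor (vcat D)" "k \<in> Mor (vcat D)"
    "src (hcat D) f = src (vcat D) j" "tgt (hcat D) f = src (vcat D) k"
    "src (hcat D) g = tgt (vcat D) j" "tgt (hcat D) g = tgt (vcat D) k"
    and eq: "cmp (hcat D) f (hol k) = cmp (hcat D) (hol j) g"
  shows "\<exists>s \<in> squares D f g j k. commuting D \<Lambda> s"
proof -
  let ?m = "cmp (hcat D) (hol j) g"
  have m: "?m \<in> Mor (hcat D)"
    using assms by (simp add: hol_simps domd.dc_simps)
  have "Quintet f g (hol j) (hol k) (ide (sqv D) ?m)
      \<in> squares (Q_cat (H_cat D)) (hord \<Lambda> f) (hord \<Lambda> g) (hol j) (hol k)"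
    using assms m domd.ide_sqv_globular[OF m]
    by (simp add: squares_def Q_cat_def quintets_def H_cat_def hord_id hol_simps domd.dc_simps)
  moreover have "bij_betw (sqd \<Lambda>) (squares D f g j k)
      (squares (Q_cat (H_cat D)) (hord \<Lambda> f) (hord \<Lambda> g) (hol j) (hol k))"
    using fully_faithful assms(1-8) unfolding fully_faithful_on_squares_def by blast
  ultimately have "Quintet f g (hol j) (hol k) (ide (sqv D) ?m) \<in> sqd \<Lambda> ` squares D f g j k"
    by (simp add: bij_betw_def)
  then obtain s where "s \<in> squares D f g j k"
    "sqd \<Lambda> s = Quintet f g (hol j) (hol k) (ide (sqv D) ?m)"
    by (elim imageE) simp
  then show ?thesis
    using m by (intro bexI[of _ s]) (simp_all add: commuting_def squares_def)
qed

lemma cell_cmp_sqh: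
  assumes "s \<in> Mor (sqv D)" "t \<in> Mor (sqv D)" "sq_right D s = sq_left D t"
  shows "cell (cmp (sqh D) s t) =
    cmp (sqv D) (cmp (sqh D) (ide (sqv D) (sq_top D s)) (cell t))
      (cmp (sqh D) (cell s) (ide (sqv D) (sq_bot D t)))"
  using df_simps(19)[OF assms] assms
  by (simp add: Q_cat_def H_cat_def lwhisk_def rwhisk_def quintet_simps)

lemma cell_cmp_sqv:
  assumes "s \<in> Mor (sqv D)" "t \<in> Mor (sqv D)" "sq_bot D s = sq_top D t"
  shows "cell (cmp (sqv D) s t) =
    cmp (sqv D) (cmp (sqh D) (cell s) (ide (sqv D) (hol (sq_right D t))))
      (cmp (sqh D) (ide (sqv D) (hol (sq_left D s))) (cell t))"
  using df_simps(20)[OF assms] assms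
  by (simp add: Q_cat_def H_cat_def lwhisk_def rwhisk_def quintet_simps)

lemma commuting_ide_sqh: "j \<in> Mor (vcat D) \<Longrightarrow> commuting D \<Lambda> (ide (sqh D) j)"
  using df_simps(15)[of j] by (simp add: commuting_def Q_cat_def H_cat_def hol_simps domd.dc_simps)

lemma commuting_ide_sqv: "f \<in> Mor (hcat D) \<Longrightarrow> commuting D \<Lambda> (ide (sqv D) f)"
  using df_simps(16)[of f] by (simp add: commuting_def Q_cat_def H_cat_def hord_id domd.dc_simps)

text \<open>An identity 2-cell has equal top and bottom; by \<open>cell_simps\<close> these are the
  two composites around the square.\<close>

lemma commutingD:
  assumes "commuting D \<Lambda> s"
  shows "s \<in> Mor (sqv D)"
    "cell s = ide (sqv D) (cmp (hcat D) (sq_top D s) (hol (sq_right D s)))"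
    "cmp (hcat D) (sq_top D s) (hol (sq_right D s)) = cmp (hcat D) (hol (sq_left D s)) (sq_bot D s)"
  using assms cell_simps(2,3)[of s] by (auto simp: commuting_def domd.dc_simps)

text \<open>The cell of a commuting square is the identity on a composite of boundary edges, so the
  boundary determines it.\<close>

lemma commuting_eqI:
  assumes "commuting D \<Lambda> s" "commuting D \<Lambda> t" "sq_top D s = sq_top D t" "sq_bot D s = sq_bot D t"
    "sq_left D s = sq_left D t" "sq_right D s = sq_right D t"
  shows "s = t"
  by (rule square_eqI[OF commutingD(1)[OF assms(1)] commutingD(1)[OF assms(2)] assms(3-6)])
    (simp add: commutingD(2)[OF assms(1)] commutingD(2)[OF assms(2)] assms(3,6))

text \<open>When \<open>t\<close> commutes, one factor of the pasted 2-cell is a whiskered identity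
  and disappears by a unit law.\<close>

lemma cell_cmp_commuting_right:
  assumes s: "s \<in> Mor (sqv D)" and t: "commuting D \<Lambda> t" and st: "sq_right D s = sq_left D t"
  shows "cell (cmp (sqh D) s t) = cmp (sqh D) (cell s) (ide (sqv D) (sq_bot D t))"
proof -
  note t' = commutingD[OF t]
  let ?w = "cmp (sqh D) (cell s) (ide (sqv D) (sq_bot D t))"
  have "?w \<in> Mor (sqv D)"
    using s t'(1) st by (simp add: domd.dc_simps cell_simps)
  \<comment> \<open>The left side is the identity on \<open>[f f' l]\<close>, the top edges of
    \<open>s\<close> and \<open>t\<close> followed by the right holonomy of \<open>t\<close>.
    Commutativity of \<open>t\<close> turns this into \<open>[f k g']\<close>, the top of
    \<open>?w\<close>.\<close>
  moreover have "cmp (sqh D) (ide (sqv D) (sq_top D s)) (cell t) = ide (sqv D) (sq_top D ?w)"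
    using s t' st by (simp add: domd.dc_simps cell_simps hol_simps domd.cmp_sqh_ide_sqv domd.hor.cmp_assoc)
  ultimately show ?thesis
    using cell_cmp_sqh[OF s t'(1) st] by (simp add: domd.sqv.ide_cmp)
qed

lemma cell_cmp_commuting_left:
  assumes s: "commuting D \<Lambda> s" and t: "t \<in> Mor (sqv D)" and st: "sq_right D s = sq_left D t"
  shows "cell (cmp (sqh D) s t) = cmp (sqh D) (ide (sqv D) (sq_top D s)) (cell t)"
proof -
  note s' = commutingD[OF s]
  let ?w = "cmp (sqh D) (ide (sqv D) (sq_top D s)) (cell t)"
  have "?w \<in> Mor (sqv D)"
    using t s'(1) st by (simp add: domd.dc_simps cell_simps)
  moreover have "cmp (sqh D) (cell s) (ide (sqv D) (sq_bot D t)) = ide (sqv D) (sq_bot D ?w)"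
    using t s'(1,2) st by (simp add: domd.dc_simps cell_simps hol_simps domd.cmp_sqh_ide_sqv domd.hor.cmp_assoc)
  ultimately show ?thesis
    using cell_cmp_sqh[OF s'(1) t st] by (simp add: domd.sqv.cmp_ide)
qed

lemma commuting_cmp_sqh:
  assumes s: "commuting D \<Lambda> s" and t: "commuting D \<Lambda> t" and st: "sq_right D s = sq_left D t"
  shows "commuting D \<Lambda> (cmp (sqh D) s t)"
  using cell_cmp_commuting_right[of s t] commutingD(1,2)[OF s] commutingD(1)[OF t] t st
  by (simp add: commuting_def domd.dc_simps hol_simps domd.cmp_sqh_ide_sqv)

lemma commuting_cmp_sqv:
  assumes s: "commuting D \<Lambda> s" and t: "commuting D \<Lambda> t" and st: "sq_bot D s = sq_top D t"
  shows "commuting D \<Lambda> (cmp (sqv D) s t)"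
proof -
  note s' = commutingD[OF s] and t' = commutingD[OF t]
  \<comment> \<open>Vertical composability of the sides follows by comparing the ends of the shared
    horizontal edge.\<close>
  have corners: "tgt (vcat D) (sq_left D s) = src (vcat D) (sq_left D t)"
    "tgt (vcat D) (sq_right D s) = src (vcat D) (sq_right D t)"
    using s'(1) t'(1) arg_cong[OF st, of "src (hcat D)"] arg_cong[OF st, of "tgt (hcat D)"]
    by (simp_all add: domd.dc_simps)
  \<comment> \<open>This is the middle 1-cell \<open>[j g k']\<close> of the vertical pasting, where
    \<open>g\<close> is the shared edge; both factors turn out to be the identity on it.\<close>
  let ?m = "cmp (hcat D) (hol (sq_left D s)) (cmp (hcat D) (sq_top D t) (hol (sq_right D t)))"
  have m: "?m \<in> Mor (hcat D)"
    using s'(1) t'(1) corners by (simp add: domd.dc_simps hol_simps)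
  have "cmp (sqh D) (cell s) (ide (sqv D) (hol (sq_right D t))) = ide (sqv D) ?m"
    using s' t'(1) corners st
    by (simp add: domd.dc_simps hol_simps domd.cmp_sqh_ide_sqv domd.hor.cmp_assoc)
  moreover have "cmp (sqh D) (ide (sqv D) (hol (sq_left D s))) (cell t) = ide (sqv D) ?m"
    using s'(1) t'(1,2) corners by (simp add: domd.dc_simps hol_simps domd.cmp_sqh_ide_sqv)
  moreover have "cmp (sqv D) (ide (sqv D) ?m) (ide (sqv D) ?m) = ide (sqv D) ?m"
    using domd.sqv.ide_cmp[of "ide (sqv D) ?m"] m by (simp add: domd.dc_simps)
  ultimately have "cell (cmp (sqv D) s t) = ide (sqv D) ?m"
    using cell_cmp_sqv[OF s'(1) t'(1) st] by simp
  then show ?thesis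
    using m s'(1) t'(1) st by (simp add: commuting_def domd.dc_simps)
qed

end

section \<open>Commuting squares for a cofolding, with the holonomies reversed\<close>

context double_cofolding
begin

abbreviation "hol \<equiv> verd \<Lambda>"
abbreviation "cell s \<equiv> qcell (sqd \<Lambda> s)"

lemma obd_id: "a \<in> Ob (hcat D) \<Longrightarrow> obd \<Lambda> a = a"
  and hord_id: "f \<in> Mor (hcat D) \<Longrightarrow> hord \<Lambda> f = f"
  using identity by (auto simp: identity_on_H_def)

lemma hol_simps:
  assumes "j \<in> Mor (vcat D)"
  shows "hol j \<in> Mor (hcat D)" "src (hcat D) (hol j) = tgt (vcat D) j"
    "tgt (hcat D) (hol j) = src (vcat D) j"
  using df_simps(3,7,8)[OF assms] assms by (auto simp: Qbar_cat_def op_cat_def H_cat_def obd_id domd.dc_simps)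

lemma quintet_simps:
  assumes "s \<in> Mor (sqv D)"
  shows "qtop (sqd \<Lambda> s) = sq_top D s" "qbot (sqd \<Lambda> s) = sq_bot D s"
    "qleft (sqd \<Lambda> s) = hol (sq_left D s)" "qright (sqd \<Lambda> s) = hol (sq_right D s)"
  using df_simps(9-12)[OF assms] assms by (auto simp: Qbar_cat_def hord_id domd.dc_simps)

lemma cell_simps:
  assumes "s \<in> Mor (sqv D)"
  shows "cell s \<in> Mor (sqv D)"
    "sq_top D (cell s) = cmp (hcat D) (hol (sq_left D s)) (sq_top D s)"
    "sq_bot D (cell s) = cmp (hcat D) (sq_bot D s) (hol (sq_right D s))"
    "sq_left D (cell s) = ide (vcat D) (tgt (vcat D) (sq_left D s))"
    "sq_right D (cell s) = ide (vcat D) (src (vcat D) (sq_right D s))"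
proof -
  have "cell s \<in> globular D"
    and top: "sq_top D (cell s) = cmp (hcat D) (hol (sq_left D s)) (sq_top D s)"
    and "sq_bot D (cell s) = cmp (hcat D) (sq_bot D s) (hol (sq_right D s))"
    using df_simps(4)[OF assms] quintet_simps[OF assms]
    by (auto simp: Qbar_cat_def inverse_quintets_def H_cat_def)
  then show "cell s \<in> Mor (sqv D)"
    "sq_top D (cell s) = cmp (hcat D) (hol (sq_left D s)) (sq_top D s)"
    "sq_bot D (cell s) = cmp (hcat D) (sq_bot D s) (hol (sq_right D s))"
    "sq_left D (cell s) = ide (vcat D) (tgt (vcat D) (sq_left D s))"
    "sq_right D (cell s) = ide (vcat D) (src (vcat D) (sq_right D s))"
    unfolding globular_def mem_Collect_eq top
    using assms by (simp_all add: hol_simps domd.dc_simps)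
qed

lemma square_eqI:
  assumes "s \<in> Mor (sqv D)" "t \<in> Mor (sqv D)" "sq_top D s = sq_top D t" "sq_bot D s = sq_bot D t"
    "sq_left D s = sq_left D t" "sq_right D s = sq_right D t" "cell s = cell t"
  shows "s = t"
proof -
  have "inj_on (sqd \<Lambda>) (squares D (sq_top D s) (sq_bot D s) (sq_left D s) (sq_right D s))"
    using fully_faithful assms(1) unfolding fully_faithful_on_squares_def
    by (simp add: bij_betw_def domd.dc_simps)
  moreover have "sqd \<Lambda> s = sqd \<Lambda> t"
    using assms by (intro quintet.expand) (simp add: quintet_simps)
  moreover have "s \<in> squares D (sq_top D s) (sq_bot D s) (sq_left D s) (sq_right D s)"
    "t \<in> squares D (sq_top D s) (sq_bot D s) (sq_left D s) (sq_right D s)"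
    using assms by (simp_all add: squares_def)
  ultimately show ?thesis by (rule inj_onD)
qed

text \<open>Fullness again, now applied to the identity 2-cell on \<open>[g k]\<close>.\<close>

lemma commuting_exists:
  assumes "f \<in> Mor (hcat D)" "g \<in> Mor (hcat D)" "j \<in> Mor (vcat D)" "k \<in> Mor (vcat D)"
    "src (hcat D) f = src (vcat D) j" "tgt (hcat D) f = src (vcat D) k"
    "src (hcat D) g = tgt (vcat D) j" "tgt (hcat D) g = tgt (vcat D) k"
    and eq: "cmp (hcat D) (hol j) f = cmp (hcat D) g (hol k)"
  shows "\<exists>s \<in> squares D f g j k. commuting D \<Lambda> s"
proof -
  let ?m = "cmp (hcat D) g (hol k)"
  have m: "?m \<in> Mor (hcat D)"
    using assms by (simp add: hol_simps domd.dc_simps)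
  have "Quintet f g (hol j) (hol k) (ide (sqv D) ?m)
      \<in> squares (Qbar_cat (H_cat D)) (hord \<Lambda> f) (hord \<Lambda> g) (hol j) (hol k)"
    using assms m domd.ide_sqv_globular[OF m]
    by (simp add: squares_def Qbar_cat_def inverse_quintets_def H_cat_def hord_id hol_simps domd.dc_simps)
  moreover have "bij_betw (sqd \<Lambda>) (squares D f g j k)
      (squares (Qbar_cat (H_cat D)) (hord \<Lambda> f) (hord \<Lambda> g) (hol j) (hol k))"
    using fully_faithful assms(1-8) unfolding fully_faithful_on_squares_def by blast
  ultimately have "Quintet f g (hol j) (hol k) (ide (sqv D) ?m) \<in> sqd \<Lambda> ` squares D f g j k"
    by (simp add: bij_betw_def)
  then obtain s where "s \<in> squares D f g j k"
    "sqd \<Lambda> s = Quintet f g (hol j) (hol k) (ide (sqv D) ?m)"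
    by (elim imageE) simp
  then show ?thesis
    using m by (intro bexI[of _ s]) (simp_all add: commuting_def squares_def)
qed

lemma cell_cmp_sqh:
  assumes "s \<in> Mor (sqv D)" "t \<in> Mor (sqv D)" "sq_right D s = sq_left D t"
  shows "cell (cmp (sqh D) s t) =
    cmp (sqv D) (cmp (sqh D) (cell s) (ide (sqv D) (sq_top D t)))
      (cmp (sqh D) (ide (sqv D) (sq_bot D s)) (cell t))"
  using df_simps(19)[OF assms] assms
  by (simp add: Qbar_cat_def H_cat_def lwhisk_def rwhisk_def quintet_simps)

lemma cell_cmp_sqv:
  assumes "s \<in> Mor (sqv D)" "t \<in> Mor (sqv D)" "sq_bot D s = sq_top D t"
  shows "cell (cmp (sqv D) s t) =
    cmp (sqv D) (cmp (sqh D) (ide (sqv D) (hol (sq_left D t))) (cell s))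
      (cmp (sqh D) (cell t) (ide (sqv D) (hol (sq_right D s))))"
  using df_simps(20)[OF assms] assms
  by (simp add: Qbar_cat_def H_cat_def lwhisk_def rwhisk_def quintet_simps)

lemma commuting_ide_sqh: "j \<in> Mor (vcat D) \<Longrightarrow> commuting D \<Lambda> (ide (sqh D) j)"
  using df_simps(15)[of j] by (simp add: commuting_def Qbar_cat_def H_cat_def hol_simps domd.dc_simps)

lemma commuting_ide_sqv: "f \<in> Mor (hcat D) \<Longrightarrow> commuting D \<Lambda> (ide (sqv D) f)"
  using df_simps(16)[of f] by (simp add: commuting_def Qbar_cat_def H_cat_def hord_id domd.dc_simps)

lemma commutingD:
  assumes "commuting D \<Lambda> s"
  shows "s \<in> Mor (sqv D)"
    "cell s = ide (sqv D) (cmp (hcat D) (hol (sq_left D s)) (sq_top D s))"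
    "cmp (hcat D) (hol (sq_left D s)) (sq_top D s) = cmp (hcat D) (sq_bot D s) (hol (sq_right D s))"
  using assms cell_simps(2,3)[of s] by (auto simp: commuting_def domd.dc_simps)

lemma commuting_eqI:
  assumes "commuting D \<Lambda> s" "commuting D \<Lambda> t" "sq_top D s = sq_top D t" "sq_bot D s = sq_bot D t"
    "sq_left D s = sq_left D t" "sq_right D s = sq_right D t"
  shows "s = t"
  by (rule square_eqI[OF commutingD(1)[OF assms(1)] commutingD(1)[OF assms(2)] assms(3-6)])
    (simp add: commutingD(2)[OF assms(1)] commutingD(2)[OF assms(2)] assms(3,5))

text \<open>Inverse quintets paste the cell of the left square first, so a commuting
  \<open>t\<close> contributes an identity as second factor, and the surviving whiskering is by the
  top of \<open>t\<close>.\<close>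

lemma cell_cmp_commuting_right:
  assumes s: "s \<in> Mor (sqv D)" and t: "commuting D \<Lambda> t" and st: "sq_right D s = sq_left D t"
  shows "cell (cmp (sqh D) s t) = cmp (sqh D) (cell s) (ide (sqv D) (sq_top D t))"
proof -
  note t' = commutingD[OF t]
  let ?w = "cmp (sqh D) (cell s) (ide (sqv D) (sq_top D t))"
  have "?w \<in> Mor (sqv D)"
    using s t'(1) st by (simp add: domd.dc_simps cell_simps)
  moreover have "cmp (sqh D) (ide (sqv D) (sq_bot D s)) (cell t) = ide (sqv D) (sq_bot D ?w)"
    using s t'(1,2) st by (simp add: domd.dc_simps cell_simps hol_simps domd.cmp_sqh_ide_sqv domd.hor.cmp_assoc)
  ultimately show ?thesis
    using cell_cmp_sqh[OF s t'(1) st] by (simp add: domd.sqv.cmp_ide)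
qed

lemma cell_cmp_commuting_left:
  assumes s: "commuting D \<Lambda> s" and t: "t \<in> Mor (sqv D)" and st: "sq_right D s = sq_left D t"
  shows "cell (cmp (sqh D) s t) = cmp (sqh D) (ide (sqv D) (sq_bot D s)) (cell t)"
proof -
  note s' = commutingD[OF s]
  let ?w = "cmp (sqh D) (ide (sqv D) (sq_bot D s)) (cell t)"
  have "?w \<in> Mor (sqv D)"
    using t s'(1) st by (simp add: domd.dc_simps cell_simps)
  \<comment> \<open>In contrast to foldings, the commutativity equation enters on the left: it turns
    \<open>[j f f']\<close> into \<open>[g k f']\<close>, the top of \<open>?w\<close>.\<close>
  moreover have "cmp (sqh D) (cell s) (ide (sqv D) (sq_top D t)) = ide (sqv D) (sq_top D ?w)"
    using t s' st by (simp add: domd.dc_simps cell_simps hol_simps domd.cmp_sqh_ide_sqv domd.hor.cmp_assoc)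
  ultimately show ?thesis
    using cell_cmp_sqh[OF s'(1) t st] by (simp add: domd.sqv.ide_cmp)
qed

lemma commuting_cmp_sqh:
  assumes s: "commuting D \<Lambda> s" and t: "commuting D \<Lambda> t" and st: "sq_right D s = sq_left D t"
  shows "commuting D \<Lambda> (cmp (sqh D) s t)"
  using cell_cmp_commuting_right[of s t] commutingD(1,2)[OF s] commutingD(1)[OF t] t st
  by (simp add: commuting_def domd.dc_simps hol_simps domd.cmp_sqh_ide_sqv)

lemma commuting_cmp_sqv:
  assumes s: "commuting D \<Lambda> s" and t: "commuting D \<Lambda> t" and st: "sq_bot D s = sq_top D t"
  shows "commuting D \<Lambda> (cmp (sqv D) s t)"
proof -
  note s' = commutingD[OF s] and t' = commutingD[OF t]
  have corners: "tgt (vcat D) (sq_left D s) = src (vcat D) (sq_left D t)"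
    "tgt (vcat D) (sq_right D s) = src (vcat D) (sq_right D t)"
    using s'(1) t'(1) arg_cong[OF st, of "src (hcat D)"] arg_cong[OF st, of "tgt (hcat D)"]
    by (simp_all add: domd.dc_simps)
  \<comment> \<open>The middle 1-cell of the vertical pasting is now \<open>[j' g k]\<close>, with
    \<open>g\<close> the shared edge.\<close>
  let ?m = "cmp (hcat D) (cmp (hcat D) (hol (sq_left D t)) (sq_top D t)) (hol (sq_right D s))"
  have m: "?m \<in> Mor (hcat D)"
    using s'(1) t'(1) corners by (simp add: domd.dc_simps hol_simps)
  have "cmp (sqh D) (ide (sqv D) (hol (sq_left D t))) (cell s) = ide (sqv D) ?m"
    using s' t'(1) corners st
    by (simp add: domd.dc_simps hol_simps domd.cmp_sqh_ide_sqv domd.hor.cmp_assoc)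
  moreover have "cmp (sqh D) (cell t) (ide (sqv D) (hol (sq_right D s))) = ide (sqv D) ?m"
    using s'(1) t'(1,2) corners by (simp add: domd.dc_simps hol_simps domd.cmp_sqh_ide_sqv)
  moreover have "cmp (sqv D) (ide (sqv D) ?m) (ide (sqv D) ?m) = ide (sqv D) ?m"
    using domd.sqv.ide_cmp[of "ide (sqv D) ?m"] m by (simp add: domd.dc_simps)
  ultimately have "cell (cmp (sqv D) s t) = ide (sqv D) ?m"
    using cell_cmp_sqv[OF s'(1) t'(1) st] by simp
  then show ?thesis
    using m s'(1) t'(1) st by (simp add: commuting_def domd.dc_simps)
qed

end


section \<open>Extension of 2-natural transformations\<close>

text \<open>What the extension argument uses of foldings (\<open>co = False\<close>) and of cofoldings
  (\<open>co = True\<close>). The 2-cell of a square with sides \<open>f\<close>, \<open>g\<close>, \<open>j\<close>, \<open>k\<close> runs from \<open>[f k]\<close> to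
  \<open>[j g]\<close> in the first case and from \<open>[j f]\<close> to \<open>[g k]\<close> in the second, so passing from one to the
  other exchanges the roles of top and bottom.\<close>

locale quintet_representation = double_category D
  for D :: "('o, 'h, 'v, 's) dcat"
    and \<Lambda> :: "('o, 'h, 'v, 's, 'o, 'h, 'h, ('h, 's) quintet) dfun" and co :: bool +
  assumes hol_in: "j \<in> Mor (vcat D) \<Longrightarrow> verd \<Lambda> j \<in> Mor (hcat D)"
    and src_hol: "j \<in> Mor (vcat D) \<Longrightarrow>
      src (hcat D) (verd \<Lambda> j) = (if co then tgt (vcat D) j else src (vcat D) j)"
    and tgt_hol: "j \<in> Mor (vcat D) \<Longrightarrow>
      tgt (hcat D) (verd \<Lambda> j) = (if co then src (vcat D) j else tgt (vcat D) j)"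
    and cell_globular: "s \<in> Mor (sqv D) \<Longrightarrow> qcell (sqd \<Lambda> s) \<in> globular D"
    and src_cell: "s \<in> Mor (sqv D) \<Longrightarrow>
      src (hcat D) (sq_top D (qcell (sqd \<Lambda> s))) = src (hcat D) (verd \<Lambda> (sq_left D s))"
    and tgt_cell: "s \<in> Mor (sqv D) \<Longrightarrow>
      tgt (hcat D) (sq_top D (qcell (sqd \<Lambda> s))) = tgt (hcat D) (verd \<Lambda> (sq_right D s))"
    and square_eqI: "\<lbrakk>s \<in> Mor (sqv D); t \<in> Mor (sqv D); sq_top D s = sq_top D t;
      sq_bot D s = sq_bot D t; sq_left D s = sq_left D t; sq_right D s = sq_right D t;
      qcell (sqd \<Lambda> s) = qcell (sqd \<Lambda> t)\<rbrakk> \<Longrightarrow> s = t"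
    and commuting_eqI: "\<lbrakk>commuting D \<Lambda> s; commuting D \<Lambda> t; sq_top D s = sq_top D t;
      sq_bot D s = sq_bot D t; sq_left D s = sq_left D t; sq_right D s = sq_right D t\<rbrakk> \<Longrightarrow> s = t"
    and commuting_exists: "\<lbrakk>f \<in> Mor (hcat D); g \<in> Mor (hcat D); j \<in> Mor (vcat D); k \<in> Mor (vcat D);
      src (hcat D) f = src (vcat D) j; tgt (hcat D) f = src (vcat D) k;
      src (hcat D) g = tgt (vcat D) j; tgt (hcat D) g = tgt (vcat D) k;
      cmp (hcat D) (verd \<Lambda> j) (if co then f else g)
        = cmp (hcat D) (if co then g else f) (verd \<Lambda> k)\<rbrakk>
      \<Longrightarrow> \<exists>s \<in> squares D f g j k. commuting D \<Lambda> s"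
    and commuting_ide_sqh: "j \<in> Mor (vcat D) \<Longrightarrow> commuting D \<Lambda> (ide (sqh D) j)"
    and commuting_ide_sqv: "f \<in> Mor (hcat D) \<Longrightarrow> commuting D \<Lambda> (ide (sqv D) f)"
    and commuting_cmp_sqh: "\<lbrakk>commuting D \<Lambda> s; commuting D \<Lambda> t; sq_right D s = sq_left D t\<rbrakk>
      \<Longrightarrow> commuting D \<Lambda> (cmp (sqh D) s t)"
    and commuting_cmp_sqv: "\<lbrakk>commuting D \<Lambda> s; commuting D \<Lambda> t; sq_bot D s = sq_top D t\<rbrakk>
      \<Longrightarrow> commuting D \<Lambda> (cmp (sqv D) s t)"
    and cell_cmp_commuting_right: "\<lbrakk>s \<in> Mor (sqv D); commuting D \<Lambda> t; sq_right D s = sq_left D t\<rbrakk>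
      \<Longrightarrow> qcell (sqd \<Lambda> (cmp (sqh D) s t)) =
        cmp (sqh D) (qcell (sqd \<Lambda> s)) (ide (sqv D) (if co then sq_top D t else sq_bot D t))"
    and cell_cmp_commuting_left: "\<lbrakk>commuting D \<Lambda> s; t \<in> Mor (sqv D); sq_right D s = sq_left D t\<rbrakk>
      \<Longrightarrow> qcell (sqd \<Lambda> (cmp (sqh D) s t)) =
        cmp (sqh D) (ide (sqv D) (if co then sq_bot D s else sq_top D s)) (qcell (sqd \<Lambda> t))"

lemma (in double_folding) quintet_representation: "quintet_representation D \<Lambda> False"
proof unfold_locales
  fix s assume s: "s \<in> Mor (sqv D)"
  note bounds = cell_simps[OF s]
  show "cell s \<in> globular D"
    using s bounds by (auto simp: domd.globular_iff domd.dc_simps)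
  show "src (hcat D) (sq_top D (cell s)) = src (hcat D) (hol (sq_left D s))"
    "tgt (hcat D) (sq_top D (cell s)) = tgt (hcat D) (hol (sq_right D s))"
    using s by (simp_all add: bounds(2) domd.dc_simps hol_simps)
qed (use commuting_exists in \<open>auto simp: hol_simps cell_cmp_commuting_right cell_cmp_commuting_left
  commuting_ide_sqh commuting_ide_sqv commuting_cmp_sqh commuting_cmp_sqv
  intro: square_eqI commuting_eqI\<close>)

text \<open>The coholonomy runs from the target to the source of \<open>j\<close>. With this
  reversal the cell still starts where the left coholonomy starts and ends where the right one ends,
  as for foldings.\<close>

lemma (in double_cofolding) quintet_representation: "quintet_representation D \<Lambda> True"
proof unfold_locales
  fix s assume s: "s \<in> Mor (sqv D)"
  note bounds = cell_simps[OF s]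
  show "cell s \<in> globular D"
    using s bounds by (auto simp: domd.globular_iff domd.dc_simps)
  show "src (hcat D) (sq_top D (cell s)) = src (hcat D) (hol (sq_left D s))"
    "tgt (hcat D) (sq_top D (cell s)) = tgt (hcat D) (hol (sq_right D s))"
    using s by (simp_all add: bounds(2) domd.dc_simps hol_simps)
qed (use commuting_exists in \<open>auto simp: hol_simps cell_cmp_commuting_right cell_cmp_commuting_left
  commuting_ide_sqh commuting_ide_sqv commuting_cmp_sqh commuting_cmp_sqv
  intro: square_eqI commuting_eqI\<close>)

section \<open>Compatible double functors and commuting squares\<close>

lemma compatible_dfun_id: "compatible D \<Lambda> \<Lambda> dfun_id"
  by (simp add: compatible_def dfun_id_def quintet.map_id)

lemma compatible_dfun_comp:
  assumes "double_functor C D F" "compatible C \<Lambda>C \<Lambda>D F" "compatible D \<Lambda>D \<Lambda>E G"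
  shows "compatible C \<Lambda>C \<Lambda>E (dfun_comp F G)"
proof -
  interpret double_functor C D F by fact
  show ?thesis
    using assms(2,3) unfolding compatible_def dfun_comp_def
    by (simp add: df_simps flip: quintet.map_comp)
qed

lemma compatible_cell:
  assumes "compatible D \<Lambda>D \<Lambda>E F" "s \<in> Mor (sqv D)"
  shows "qcell (sqd \<Lambda>E (sqd F s)) = sqd F (qcell (sqd \<Lambda>D s))"
proof -
  have "qcell (sqd \<Lambda>E (sqd F s)) = qcell (map_quintet (hord F) (sqd F) (sqd \<Lambda>D s))"
    using assms by (simp add: compatible_def)
  then show ?thesis by (simp add: quintet.map_sel)
qed

text \<open>Compatibility identifies the cell of \<open>sqd F s\<close> with the image of the cell
  of \<open>s\<close>, and \<open>F\<close> preserves vertical identity squares.\<close>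

lemma commuting_map:
  assumes "double_functor D E F" "compatible D \<Lambda>D \<Lambda>E F" "commuting D \<Lambda>D s"
  shows "commuting E \<Lambda>E (sqd F s)"
proof -
  interpret double_functor D E F by fact
  show ?thesis
    using assms(3) compatible_cell[OF assms(2)] by (auto simp: commuting_def df_simps)
qed

text \<open>The setting for extending \<open>\<sigma>\<close> from the horizontal 2-categories to
  the double categories; it is instantiated for both unit and counit. The common \<open>co\<close>
  makes both representations of the same kind.\<close>

locale quintet_transformation =
  F: double_functor D E F + G: double_functor D E G +
  dom: quintet_representation D \<Lambda>D co + cod: quintet_representation E \<Lambda>E co +
  two_natural_transformation "H_cat D" "H_cat E" "H_fun F" "H_fun G" \<sigma>
  for D :: "('o, 'h, 'v, 's) dcat" and E :: "('p, 'k, 'w, 't) dcat"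
    and F G :: "('o, 'h, 'v, 's, 'p, 'k, 'w, 't) dfun"
    and \<Lambda>D :: "('o, 'h, 'v, 's, 'o, 'h, 'h, ('h, 's) quintet) dfun"
    and \<Lambda>E :: "('p, 'k, 'w, 't, 'p, 'k, 'k, ('k, 't) quintet) dfun"
    and co :: bool and \<sigma> :: "'o \<Rightarrow> 'k" +
  assumes compatible_F: "compatible D \<Lambda>D \<Lambda>E F" and compatible_G: "compatible D \<Lambda>D \<Lambda>E G"
begin

text \<open>For vertical \<open>j\<close> the choice is canonical: such a square exists by
  \<open>component_simps\<close> and is unique by \<open>commuting_eqI\<close>.\<close>

definition component :: "'v \<Rightarrow> 't" where
  "component j = (SOME s. commuting E \<Lambda>E s \<and>
     s \<in> squares E (\<sigma> (src (vcat D) j)) (\<sigma> (tgt (vcat D) j)) (verd F j) (verd G j))"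

lemma \<sigma>_simps:
  assumes "a \<in> Ob (hcat D)"
  shows "\<sigma> a \<in> Mor (hcat E)" "src (hcat E) (\<sigma> a) = obd F a" "tgt (hcat E) (\<sigma> a) = obd G a"
  using comp_in[of a] src_comp[of a] tgt_comp[of a] assms by (simp_all add: H_cat_def H_fun_def)

lemma natural_hor:
  "f \<in> Mor (hcat D) \<Longrightarrow>
    cmp (hcat E) (hord F f) (\<sigma> (tgt (hcat D) f)) = cmp (hcat E) (\<sigma> (src (hcat D) f)) (hord G f)"
  using natural1[of f] by (simp add: H_cat_def H_fun_def)

lemma natural_globular:
  "c \<in> globular D \<Longrightarrow>
    cmp (sqh E) (sqd F c) (ide (sqv E) (\<sigma> (tgt (hcat D) (sq_top D c))))
    = cmp (sqh E) (ide (sqv E) (\<sigma> (src (hcat D) (sq_top D c)))) (sqd G c)"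
  using natural2[of c] by (simp add: H_cat_def H_fun_def)

lemma component_simps:
  assumes j: "j \<in> Mor (vcat D)"
  shows "commuting E \<Lambda>E (component j)" "component j \<in> Mor (sqv E)"
    "sq_top E (component j) = \<sigma> (src (vcat D) j)" "sq_bot E (component j) = \<sigma> (tgt (vcat D) j)"
    "sq_left E (component j) = verd F j" "sq_right E (component j) = verd G j"
proof -
  have "hord F (verd \<Lambda>D j) = verd \<Lambda>E (verd F j)" "hord G (verd \<Lambda>D j) = verd \<Lambda>E (verd G j)"
    using compatible_F compatible_G j by (simp_all add: compatible_def)
  \<comment> \<open>This is naturality of \<open>\<sigma>\<close> at the holonomy of
    \<open>j\<close>. A coholonomy runs backwards, which exchanges the components at the source and
    target of \<open>j\<close>.\<close>
  then have "cmp (hcat E) (verd \<Lambda>E (verd F j)) (\<sigma> (if co then src (vcat D) j else tgt (vcat D) j))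
      = cmp (hcat E) (\<sigma> (if co then tgt (vcat D) j else src (vcat D) j)) (verd \<Lambda>E (verd G j))"
    using natural_hor[OF dom.hol_in[OF j]] dom.src_hol[OF j] dom.tgt_hol[OF j] by simp
  then have "\<exists>s \<in> squares E (\<sigma> (src (vcat D) j)) (\<sigma> (tgt (vcat D) j)) (verd F j) (verd G j).
      commuting E \<Lambda>E s"
    using j by (intro cod.commuting_exists)
      (auto simp: \<sigma>_simps F.domd.dc_simps F.df_simps G.df_simps)
  then have "\<exists>s. commuting E \<Lambda>E s \<and>
      s \<in> squares E (\<sigma> (src (vcat D) j)) (\<sigma> (tgt (vcat D) j)) (verd F j) (verd G j)"
    by blast
  then have "commuting E \<Lambda>E (component j) \<and> component j
      \<in> squares E (\<sigma> (src (vcat D) j)) (\<sigma> (tgt (vcat D) j)) (verd F j) (verd G j)"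
    unfolding component_def by (rule someI_ex)
  then show "commuting E \<Lambda>E (component j)" "component j \<in> Mor (sqv E)"
    "sq_top E (component j) = \<sigma> (src (vcat D) j)" "sq_bot E (component j) = \<sigma> (tgt (vcat D) j)"
    "sq_left E (component j) = verd F j" "sq_right E (component j) = verd G j"
    by (simp_all add: squares_def)
qed

text \<open>Both composites contain a commuting factor, so their cells are whiskerings of the images
  of the cell of \<open>s\<close>. These agree by 2-naturality, and the boundaries agree by
  naturality at 1-cells.\<close>

lemma natural_square:
  assumes s: "s \<in> Mor (sqv D)"
  shows "cmp (sqh E) (sqd F s) (component (sq_right D s))
    = cmp (sqh E) (component (sq_left D s)) (sqd G s)"
proof -
  let ?l = "sq_left D s" and ?r = "sq_right D s" and ?c = "qcell (sqd \<Lambda>D s)"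
  have l: "?l \<in> Mor (vcat D)" and r: "?r \<in> Mor (vcat D)"
    using s by (simp_all add: F.domd.dc_simps)
  note lc = component_simps[OF l] and rc = component_simps[OF r]
  have Fs: "sqd F s \<in> Mor (sqv E)" "sq_right E (sqd F s) = sq_left E (component ?r)"
    and Gs: "sqd G s \<in> Mor (sqv E)" "sq_right E (component ?l) = sq_left E (sqd G s)"
    using s rc lc by (simp_all add: F.df_simps G.df_simps)
  \<comment> \<open>The whiskering edge is the bottom of the component for foldings and its top for
    cofoldings. In both cases it is \<open>\<sigma>\<close> at the target of the holonomy of
    \<open>?r\<close>, where the cell \<open>?c\<close> ends.\<close>
  have "qcell (sqd \<Lambda>E (cmp (sqh E) (sqd F s) (component ?r)))
      = cmp (sqh E) (sqd F ?c) (ide (sqv E) (\<sigma> (tgt (hcat D) (sq_top D ?c))))"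
    unfolding cod.cell_cmp_commuting_right[OF Fs(1) rc(1) Fs(2)] compatible_cell[OF compatible_F s]
      dom.tgt_cell[OF s] dom.tgt_hol[OF r] rc(3,4) by simp
  also have "\<dots> = cmp (sqh E) (ide (sqv E) (\<sigma> (src (hcat D) (sq_top D ?c)))) (sqd G ?c)"
    using dom.cell_globular[OF s] by (rule natural_globular)
  also have "\<dots> = qcell (sqd \<Lambda>E (cmp (sqh E) (component ?l) (sqd G s)))"
    unfolding cod.cell_cmp_commuting_left[OF lc(1) Gs(1) Gs(2)] compatible_cell[OF compatible_G s]
      dom.src_cell[OF s] dom.src_hol[OF l] lc(3,4) by simp
  finally have cells: "qcell (sqd \<Lambda>E (cmp (sqh E) (sqd F s) (component ?r)))
      = qcell (sqd \<Lambda>E (cmp (sqh E) (component ?l) (sqd G s)))" .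
  have tops:
    "cmp (hcat E) (hord F (sq_top D s)) (\<sigma> (src (vcat D) ?r))
      = cmp (hcat E) (\<sigma> (src (vcat D) ?l)) (hord G (sq_top D s))"
    and bots: "cmp (hcat E) (hord F (sq_bot D s)) (\<sigma> (tgt (vcat D) ?r))
      = cmp (hcat E) (\<sigma> (tgt (vcat D) ?l)) (hord G (sq_bot D s))"
    using natural_hor[of "sq_top D s"] natural_hor[of "sq_bot D s"] s
    by (simp_all add: F.domd.dc_simps)
  show ?thesis
  proof (rule cod.square_eqI[OF _ _ _ _ _ _ cells])
    show "sq_top E (cmp (sqh E) (sqd F s) (component ?r)) = sq_top E (cmp (sqh E) (component ?l) (sqd G s))"
      "sq_bot E (cmp (sqh E) (sqd F s) (component ?r)) = sq_bot E (cmp (sqh E) (component ?l) (sqd G s))"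
      using s lc rc Fs Gs tops bots by (simp_all add: F.codd.dc_simps F.df_simps G.df_simps)
  qed (use s lc rc Fs Gs in \<open>simp_all add: F.codd.dc_simps F.df_simps G.df_simps\<close>)
qed

text \<open>Identities and composites of vertical morphisms are respected by uniqueness: each
  equation compares two commuting squares with the same boundary.\<close>

lemma horizontal_transformation: "horizontal_transformation D E F G \<sigma> component"
proof -
  have "component (ide (vcat D) a) = ide (sqv E) (\<sigma> a)" if "a \<in> Ob (hcat D)" for a
    using that component_simps[of "ide (vcat D) a"]
    by (intro cod.commuting_eqI)
      (simp_all add: \<sigma>_simps F.domd.dc_simps F.codd.dc_simps cod.commuting_ide_sqv F.df_simps G.df_simps)
  moreover have "component (cmp (vcat D) j k) = cmp (sqv E) (component j) (component k)"
    if "j \<in> Mor (vcat D)" "k \<in> Mor (vcat D)" "tgt (vcat D) j = src (vcat D) k" for j k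
    using that component_simps[of "cmp (vcat D) j k"] component_simps[of j] component_simps[of k]
    by (intro cod.commuting_eqI)
      (simp_all add: F.domd.dc_simps F.codd.dc_simps cod.commuting_cmp_sqv F.df_simps G.df_simps)
  ultimately show ?thesis
    by unfold_locales
      (auto simp: component_simps \<sigma>_simps natural_square F.domd.dc_simps F.codd.dc_simps)
qed

end


section \<open>The adjunctions\<close>

lemma two_adjoint_imp_horizontal_double_adjoint:
  fixes X :: "('o, 'h, 'v, 's) dcat" and A :: "('p, 'k, 'w, 't) dcat"
  assumes F: "double_functor X A F" and G: "double_functor A X G"
    and reps: "quintet_representation X \<Lambda>X co" "quintet_representation A \<Lambda>A co"
    and cF: "compatible X \<Lambda>X \<Lambda>A F" and cG: "compatible A \<Lambda>A \<Lambda>X G"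
    and adj: "two_adjoint (H_cat X) (H_cat A) (H_fun F) (H_fun G)"
  shows "horizontal_double_adjoint X A F G"
proof -
  interpret F: double_functor X A F by fact
  interpret G: double_functor A X G by fact
  interpret RX: quintet_representation X \<Lambda>X co by fact
  interpret RA: quintet_representation A \<Lambda>A co by fact
  obtain \<eta> \<epsilon> where "two_adjunction (H_cat X) (H_cat A) (H_fun F) (H_fun G) \<eta> \<epsilon>"
    using adj unfolding two_adjoint_def by blast
  then interpret adj: two_adjunction "H_cat X" "H_cat A" "H_fun F" "H_fun G" \<eta> \<epsilon> .
  \<comment> \<open>Identities and composites of compatible double functors are compatible, so
    \<open>\<eta>\<close> extends to vertical morphisms; likewise \<open>\<epsilon>\<close>
    below.\<close>
  interpret unit: quintet_transformation X X dfun_id "dfun_comp F G" \<Lambda>X \<Lambda>X co \<eta>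
    using double_functor_dfun_id[OF F.domd.double_category_axioms] double_functor_dfun_comp[OF F G]
      RX.quintet_representation_axioms adj.unit.two_natural_transformation_axioms
      compatible_dfun_id compatible_dfun_comp[OF F cF cG]
    by (simp add: quintet_transformation_def quintet_transformation_axioms_def
        H_fun_dfun_id H_fun_dfun_comp)
  interpret counit: quintet_transformation A A "dfun_comp G F" dfun_id \<Lambda>A \<Lambda>A co \<epsilon>
    using double_functor_dfun_id[OF F.codd.double_category_axioms] double_functor_dfun_comp[OF G F]
      RA.quintet_representation_axioms adj.counit.two_natural_transformation_axioms
      compatible_dfun_id compatible_dfun_comp[OF G cG cF]
    by (simp add: quintet_transformation_def quintet_transformation_axioms_def
        H_fun_dfun_id H_fun_dfun_comp)
  have triangle_left: "cmp (hcat A) (hord F (\<eta> x)) (\<epsilon> (obd F x)) = ide (hcat A) (obd F x)"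
    if "x \<in> Ob (hcat X)" for x
    using adj.triangle_left[of x] that by (simp add: H_cat_def H_fun_def)
  have triangle_right: "cmp (hcat X) (\<eta> (obd G a)) (hord G (\<epsilon> a)) = ide (hcat X) (obd G a)"
    if "a \<in> Ob (hcat A)" for a
    using adj.triangle_right[of a] that by (simp add: H_cat_def H_fun_def)
  have triangle_left_ver:
    "cmp (sqh A) (sqd F (unit.component j)) (counit.component (verd F j)) = ide (sqh A) (verd F j)"
    if j: "j \<in> Mor (vcat X)" for j
  proof -
    have Fj: "verd F j \<in> Mor (vcat A)" using j by (rule F.df_simps)
    have u: "commuting X \<Lambda>X (unit.component j)" "unit.component j \<in> Mor (sqv X)"
      "sq_top X (unit.component j) = \<eta> (src (vcat X) j)"
      "sq_bot X (unit.component j) = \<eta> (tgt (vcat X) j)"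
      "sq_left X (unit.component j) = j" "sq_right X (unit.component j) = verd G (verd F j)"
      using unit.component_simps[OF j] by (simp_all add: dfun_id_def dfun_comp_def)
    have c: "commuting A \<Lambda>A (counit.component (verd F j))"
      "counit.component (verd F j) \<in> Mor (sqv A)"
      "sq_top A (counit.component (verd F j)) = \<epsilon> (obd F (src (vcat X) j))"
      "sq_bot A (counit.component (verd F j)) = \<epsilon> (obd F (tgt (vcat X) j))"
      "sq_left A (counit.component (verd F j)) = verd F (verd G (verd F j))"
      "sq_right A (counit.component (verd F j)) = verd F j"
      using counit.component_simps[OF Fj] j by (simp_all add: dfun_id_def dfun_comp_def F.df_simps)
    have meet: "sq_right A (sqd F (unit.component j)) = sq_left A (counit.component (verd F j))"
      using u c by (simp add: F.df_simps)
    \<comment> \<open>Compatibility of \<open>F\<close> carries the commuting unit square to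
      \<open>A\<close>, where it can be composed with the counit square.\<close>
    have "commuting A \<Lambda>A (sqd F (unit.component j))"
      using F cF u(1) by (rule commuting_map)
    then have "commuting A \<Lambda>A (cmp (sqh A) (sqd F (unit.component j)) (counit.component (verd F j)))"
      using c(1) meet by (rule RA.commuting_cmp_sqh)
    moreover have "commuting A \<Lambda>A (ide (sqh A) (verd F j))"
      using Fj by (rule RA.commuting_ide_sqh)
    \<comment> \<open>Two commuting squares remain to be compared on boundaries. Their tops and
      bottoms agree by the triangle identity at the source and target of \<open>j\<close>.\<close>
    ultimately show ?thesis
      by (rule RA.commuting_eqI)
        (use u(2-) c(2-) Fj j in \<open>simp_all add: F.df_simps F.domd.dc_simps F.codd.dc_simps triangle_left\<close>)
  qed
  have triangle_right_ver:
    "cmp (sqh X) (unit.component (verd G k)) (sqd G (counit.component k)) = ide (sqh X) (verd G k)"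
    if k: "k \<in> Mor (vcat A)" for k
  proof -
    have Gk: "verd G k \<in> Mor (vcat X)" using k by (rule G.df_simps)
    have u: "commuting X \<Lambda>X (unit.component (verd G k))"
      "unit.component (verd G k) \<in> Mor (sqv X)"
      "sq_top X (unit.component (verd G k)) = \<eta> (obd G (src (vcat A) k))"
      "sq_bot X (unit.component (verd G k)) = \<eta> (obd G (tgt (vcat A) k))"
      "sq_left X (unit.component (verd G k)) = verd G k"
      "sq_right X (unit.component (verd G k)) = verd G (verd F (verd G k))"
      using unit.component_simps[OF Gk] k by (simp_all add: dfun_id_def dfun_comp_def G.df_simps)
    have c: "commuting A \<Lambda>A (counit.component k)" "counit.component k \<in> Mor (sqv A)"
      "sq_top A (counit.component k) = \<epsilon> (src (vcat A) k)"
      "sq_bot A (counit.component k) = \<epsilon> (tgt (vcat A) k)"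
      "sq_left A (counit.component k) = verd F (verd G k)" "sq_right A (counit.component k) = k"
      using counit.component_simps[OF k] by (simp_all add: dfun_id_def dfun_comp_def)
    have meet: "sq_right X (unit.component (verd G k)) = sq_left X (sqd G (counit.component k))"
      using u c by (simp add: G.df_simps)
    have "commuting X \<Lambda>X (sqd G (counit.component k))"
      using G cG c(1) by (rule commuting_map)
    with u(1) have
      "commuting X \<Lambda>X (cmp (sqh X) (unit.component (verd G k)) (sqd G (counit.component k)))"
      using meet by (rule RX.commuting_cmp_sqh)
    moreover have "commuting X \<Lambda>X (ide (sqh X) (verd G k))"
      using Gk by (rule RX.commuting_ide_sqh)
    \<comment> \<open>Again only boundaries matter, through the other triangle identity at the two
      ends of \<open>k\<close>.\<close>
    ultimately show ?thesis
      by (rule RX.commuting_eqI)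
        (use u(2-) c(2-) Gk k in \<open>simp_all add: G.df_simps F.domd.dc_simps F.codd.dc_simps triangle_right\<close>)
  qed
  have "horizontal_double_adjunction X A F G \<eta> unit.component \<epsilon> counit.component"
    using F G unit.horizontal_transformation counit.horizontal_transformation
      triangle_left triangle_right triangle_left_ver triangle_right_ver
    by (simp add: horizontal_double_adjunction_def horizontal_double_adjunction_axioms_def)
  then show ?thesis
    unfolding horizontal_double_adjoint_def by blast
qed

theorem proposition6p10:
  fixes X :: "('o, 'h, 'v, 's) dcat" and A :: "('p, 'k, 'w, 't) dcat"
    and F :: "('o, 'h, 'v, 's, 'p, 'k, 'w, 't) dfun"
    and G :: "('p, 'k, 'w, 't, 'o, 'h, 'v, 's) dfun"
    and \<Lambda>X :: "('o, 'h, 'v, 's, 'o, 'h, 'h, ('h, 's) quintet) dfun"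
    and \<Lambda>A :: "('p, 'k, 'w, 't, 'p, 'k, 'k, ('k, 't) quintet) dfun"
  assumes "double_category A" and "double_category X"
    and "double_functor X A F" and "double_functor A X G"
    and "(double_folding A \<Lambda>A \<and> double_folding X \<Lambda>X) \<or>
         (double_cofolding A \<Lambda>A \<and> double_cofolding X \<Lambda>X)"
    and "compatible X \<Lambda>X \<Lambda>A F" and "compatible A \<Lambda>A \<Lambda>X G"
  shows "horizontal_double_adjoint X A F G
    \<longleftrightarrow> two_adjoint (H_cat X) (H_cat A) (H_fun F) (H_fun G)"
proof
  assume "horizontal_double_adjoint X A F G"
  then show "two_adjoint (H_cat X) (H_cat A) (H_fun F) (H_fun G)"
    unfolding horizontal_double_adjoint_def two_adjoint_def
    by (blast dest: horizontal_double_adjunction.two_adjunction_H)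
next
  assume adj: "two_adjoint (H_cat X) (H_cat A) (H_fun F) (H_fun G)"
  \<comment> \<open>Each disjunct gives \<open>A\<close> and \<open>X\<close> the same kind of
    structure, so a single value of \<open>co\<close> represents both.\<close>
  from assms(5) show "horizontal_double_adjoint X A F G"
  proof (elim disjE conjE)
    assume "double_folding A \<Lambda>A" "double_folding X \<Lambda>X"
    then show ?thesis
      by (intro two_adjoint_imp_horizontal_double_adjoint[where co = False,
            OF assms(3,4) _ _ assms(6,7) adj]
          double_folding.quintet_representation)
  next
    assume "double_cofolding A \<Lambda>A" "double_cofolding X \<Lambda>X"
    then show ?thesis
      by (intro two_adjoint_imp_horizontal_double_adjoint[where co = True,
            OF assms(3,4) _ _ assms(6,7) adj]
          double_cofolding.quintet_representation)
  qed
qed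

end
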